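(* Let $n\ge 5$, let $T\subseteq V(G_n)$, and put $U=V(G_n)\setminus T$, $U_X=U\cap X$, $U_Y=U\cap Y$. Then $T$ has the cut point property in $G_n$ (i.e. $T\in\mathcal C(G_n)$) if and only if one of the following mutually exclusive conditions holds: (i) $T=\varnothing$. (ii) $U=X$ or $U=Y$. (iii) $U=X\cup\{v_i\}$ or $U=Y\cup\{u_i\}$ for some $i\in\mathbb Z_n$. (iv) $U=X\cup\{v_i,v_{i+1}\}$ or $U=Y\cup\{u_i,u_{i+1}\}$ for some $i\in\mathbb Z_n$. (v) $(|U_X|,|U_Y|)\in\{(3,2),(2,3)\}$ and $F_n[U]\cong P_5$. (vi) $(|U_X|,|U_Y|)\in\{(4,2),(2,4)\}$ and $F_n[U]\cong 2P_3$, where the two vertices in the smaller part are the centres of the two copies of $P_3$. (vii) $|U_X|=|U_Y|=3$ and ($F_n[U]\cong P_6$ or $F_n[U]\cong 2P_3$).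
   Context: Graph $G_n$: let $X=\{u_0,\dots,u_{n-1}\}$ and $Y=\{v_0,\dots,v_{n-1}\}$ be disjoint sets of $n$ elements each, indices read modulo $n$ ($\mathbb Z_n=\mathbb Z/n\mathbb Z$). Let $F_n\cong C_{2n}$ be the cycle on $X\sqcup Y$ with edge set $\{\{u_i,v_i\},\{u_i,v_{i-1}\}: i\in\mathbb Z_n\}$. Then $G_n=K_{X,Y}\setminus E(F_n)$ is the bipartite complement of $F_n$: $\{u_i,v_j\}\in E(G_n)$ iff $j\notin\{i,i-1\}$ modulo $n$, and there are no other edges. Vertex set $V(G_n)=X\sqcup Y$. For a graph $G$ and $U\subseteq V(G)$, $G[U]$ is the induced subgraph. $P_r$ denotes the path on $r$ vertices and $2P_3=P_3\sqcup P_3$ the disjoint union of two copies of $P_3$. Cut point property: for a finite simple graph $G$ and $T\subseteq V(G)$ let $c_G(T)$ be the number of connected components of the induced subgraph of $G$ on $V(G)\setminus T$ (with $c_G(V(G))=0$). $T$ has the cut point property if $T=\varnothing$, or if $c_G(T\setminus\{i\})<c_G(T)$ for every $i\in T$ (equivalently, every $i\in T$ is a cut vertex of the induced subgraph on $(V(G)\setminus T)\cup\{i\}$). $\mathcal C(G)$ denotes the set of all $T\subseteq V(G)$ with the cut point property. *)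

theory Defs
  imports "Graph_Theory.Graph_Theory"
begin

text \<open>
  A finite simple graph is a \<^locale>\<open>pair_graph\<close>, that is, a finite symmetric digraph
  without loops; the edge \<open>{a, b}\<close> is represented by the two arcs \<open>(a, b)\<close> and \<open>(b, a)\<close>.
  The induced subgraph on \<open>U\<close> is \<open>G \<restriction> U\<close>, and \<^const>\<open>digraph_iso\<close> is graph isomorphism.
\<close>

definition undirected :: "'a set \<Rightarrow> 'a rel \<Rightarrow> 'a pair_pre_digraph" where
  "undirected V E = \<lparr> pverts = V, parcs = E \<union> E\<inverse> \<rparr>"

text \<open>
  In a symmetric digraph reachability is symmetric, so the strong components are
  the connected components.
\<close>

definition num_components :: "('a, 'b) pre_digraph \<Rightarrow> nat" where
  "num_components G = card (pre_digraph.sccs_verts G)"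

definition cut_count :: "('a, 'b) pre_digraph \<Rightarrow> 'a set \<Rightarrow> nat" where
  "cut_count G T = num_components (G \<restriction> (verts G - T))"

definition cut_point_property :: "('a, 'b) pre_digraph \<Rightarrow> 'a set \<Rightarrow> bool" where
  "cut_point_property G T \<longleftrightarrow>
     T = {} \<or> (\<forall>i\<in>T. cut_count G (T - {i}) < cut_count G T)"

definition cut_sets :: "('a, 'b) pre_digraph \<Rightarrow> 'a set set" where
  "cut_sets G = {T. T \<subseteq> verts G \<and> cut_point_property G T}"

definition path_graph :: "nat \<Rightarrow> nat pair_pre_digraph" where
  "path_graph r = undirected {..<r} {(i, Suc i) | i. Suc i < r}"

definition disjoint_union ::
  "'a pair_pre_digraph \<Rightarrow> 'b pair_pre_digraph \<Rightarrow> ('a + 'b) pair_pre_digraph" where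
  "disjoint_union G H =
     \<lparr> pverts = pverts G <+> pverts H,
       parcs = map_prod Inl Inl ` parcs G \<union> map_prod Inr Inr ` parcs H \<rparr>"

definition two_P3 :: "(nat + nat) pair_pre_digraph" where
  "two_P3 = disjoint_union (path_graph 3) (path_graph 3)"

text \<open>
  The vertices of \<open>path_graph 3\<close> are \<open>0\<close>, \<open>1\<close>, \<open>2\<close>, in this order along the path, so its
  centre is \<open>1\<close>.
\<close>

definition iso_two_P3_with_centres :: "('a, 'b) pre_digraph \<Rightarrow> 'a set \<Rightarrow> bool" where
  "iso_two_P3_with_centres G S \<longleftrightarrow>
     (\<exists>f. pre_digraph.digraph_isomorphism G f \<and> with_proj two_P3 = app_iso f G \<and>
          iso_verts f ` S = {Inl 1, Inr 1})"

text \<open>\<open>\<int>/n\<int>\<close> is represented by the residues \<open>0, \<dots>, n - 1\<close>; \<open>ux i\<close> is \<open>u\<^sub>i\<close> and \<open>vy i\<close> is \<open>v\<^sub>i\<close>.\<close>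

datatype vertex = ux int | vy int

definition Zn :: "nat \<Rightarrow> int set" where
  "Zn n = {0..<int n}"

definition Xn :: "nat \<Rightarrow> vertex set" where
  "Xn n = ux ` Zn n"

definition Yn :: "nat \<Rightarrow> vertex set" where
  "Yn n = vy ` Zn n"

definition Fn :: "nat \<Rightarrow> vertex pair_pre_digraph" where
  "Fn n = undirected (Xn n \<union> Yn n)
     ({(ux i, vy i) | i. i \<in> Zn n} \<union> {(ux i, vy ((i - 1) mod int n)) | i. i \<in> Zn n})"

definition Gn :: "nat \<Rightarrow> vertex pair_pre_digraph" where
  "Gn n = \<lparr> pverts = Xn n \<union> Yn n, parcs = (Xn n \<times> Yn n \<union> Yn n \<times> Xn n) - parcs (Fn n) \<rparr>"

lemma Gn_edge_iff:
  assumes "i \<in> Zn n" "j \<in> Zn n"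
  shows "(ux i, vy j) \<in> parcs (Gn n) \<longleftrightarrow> j \<notin> {i, (i - 1) mod int n}"
  using assms by (auto simp: Gn_def Fn_def undirected_def Xn_def Yn_def)

lemma pair_graph_Fn: "pair_graph (Fn n)"
proof
  have sub: "parcs (Fn n) \<subseteq> (Xn n \<union> Yn n) \<times> (Xn n \<union> Yn n)"
    by (auto simp: Fn_def undirected_def Xn_def Yn_def Zn_def)
  then show "fst e \<in> pverts (Fn n)" "snd e \<in> pverts (Fn n)" if "e \<in> parcs (Fn n)" for e
    using that by (auto simp: Fn_def undirected_def)
  show "finite (pverts (Fn n))"
    by (simp add: Fn_def undirected_def Xn_def Yn_def Zn_def)
  show "finite (parcs (Fn n))"
    by (rule finite_subset[OF sub]) (simp add: Xn_def Yn_def Zn_def)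
  show "fst e \<noteq> snd e" if "e \<in> parcs (Fn n)" for e
    using that by (auto simp: Fn_def undirected_def)
  show "symmetric (with_proj (Fn n))"
    by (auto simp: symmetric_def sym_def Fn_def undirected_def)
qed

lemma pair_graph_Gn: "pair_graph (Gn n)"
proof
  show "fst e \<in> pverts (Gn n)" "snd e \<in> pverts (Gn n)" if "e \<in> parcs (Gn n)" for e
    using that by (auto simp: Gn_def)
  show "finite (pverts (Gn n))" "finite (parcs (Gn n))"
    by (simp_all add: Gn_def Xn_def Yn_def Zn_def)
  show "fst e \<noteq> snd e" if "e \<in> parcs (Gn n)" for e
    using that by (auto simp: Gn_def Xn_def Yn_def)
  show "symmetric (with_proj (Gn n))"
    by (auto simp: symmetric_def sym_def Gn_def Fn_def undirected_def)
qed

lemma cut_count_verts: "cut_count G (verts G) = 0"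
proof -
  have "pre_digraph.sccs_verts (G \<restriction> {}) = {}"
    by (auto simp: pre_digraph.sccs_verts_def reachable_def elim!: rtrancl_on.cases)
  then show ?thesis
    by (simp add: cut_count_def num_components_def)
qed

end

theory Submission
  imports Defs
begin

text \<open>
  A vertex \<open>t\<close> of \<open>T\<close> lowers the number of components when it is put back exactly if it is adjacent
  to at least two components of \<open>G[U]\<close>. Equivalently, \<open>U\<close> splits into two parts with no edge between
  them, both of which contain a neighbour of \<open>t\<close> (\<open>cut_sets_iff_separates\<close>). In this form neither
  components nor reachability occur in the rest of the argument.

  In a bipartite complement \<open>G = K\<^bsub>X,Y\<^esub> - F\<close> a split of \<open>U\<close> is a strong condition: every vertex of one
  part is \<open>F\<close>-adjacent to every vertex of the opposite side in the other part, while \<open>F\<close> has all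
  degrees \<open>2\<close> and no 4-cycle. If \<open>U\<close> has at least three vertices on both sides, a count leaves only
  splits of the shape \<open>(2 + 2, 1 + 1)\<close>, and the two vertices of the small part together with their
  \<open>F\<close>-neighbours are all of \<open>U\<close>. If \<open>U\<close> has at most two vertices on a side, then a vertex \<open>t\<close> of \<open>T\<close> on
  the opposite side needs two neighbours among them, in different parts of a split, which again pins
  \<open>U\<close> down. The outcome (\<open>admissible_remainder\<close>) is that \<open>U\<close> is \<open>X\<close>, or \<open>X\<close> with one vertex of \<open>Y\<close>, or \<open>X\<close> with the two
  \<open>F\<close>-neighbours of a vertex of \<open>X\<close>, or one of these with the sides exchanged, or a union
  \<open>N[a] \<union> N[b]\<close> of closed \<open>F\<close>-neighbourhoods of two distinct vertices not adjacent in \<open>F\<close>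
  (\<open>two_stars\<close>). Conversely each such set has, for every deleted vertex \<open>t\<close>, an explicit split seen by
  \<open>t\<close> (\<open>admissible_imp_separated\<close>).

  The last family is exactly the three path conditions taken together. In an induced \<open>P\<^sub>5\<close>, \<open>P\<^sub>6\<close> or
  \<open>2P\<^sub>3\<close> of a 2-regular graph two suitable inner vertices already have all their neighbours, and in
  the other direction \<open>F[N[a] \<union> N[b]]\<close> is \<open>P\<^sub>5\<close> or \<open>2P\<^sub>3\<close> if \<open>a\<close> and \<open>b\<close> lie on the same side, and \<open>P\<^sub>6\<close>
  or \<open>2P\<^sub>3\<close> otherwise, because \<open>F\<close> has no 6-cycle (\<open>two_stars_iff_induced_copy\<close>). Exclusiveness of
  the conditions is a matter of comparing \<open>|U\<^sub>X|\<close> and \<open>|U\<^sub>Y|\<close>.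
\<close>

section \<open>Components and separations\<close>

text \<open>
  Components as the nonempty connected sets with no edge to the rest of \<open>U\<close>. For a symmetric relation
  this agrees with the maximality in the definition of strong components, and it is easier to verify.
\<close>

definition components :: "'a rel \<Rightarrow> 'a set \<Rightarrow> 'a set set" where
  "components E U = {S. S \<noteq> {} \<and> S \<subseteq> U \<and> (\<forall>a\<in>S. \<forall>b\<in>S. (a, b) \<in> rtrancl_on U E) \<and>
     (\<forall>a\<in>S. \<forall>b\<in>U - S. (a, b) \<notin> E)}"

lemma reach_closed:
  assumes "(a, b) \<in> rtrancl_on U E" "a \<in> S" "\<forall>a\<in>S. \<forall>b\<in>U - S. (a, b) \<notin> E"
  shows "b \<in> S"
  using assms by (induct rule: rtrancl_on_induct) auto

lemma component_exists:
  assumes "sym E" "a \<in> U"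
  shows "\<exists>C\<in>components E U. a \<in> C"
proof -
  have s: "sym (rtrancl_on U E)" using assms(1) by (rule rtrancl_on_sym)
  define C where "C = rtrancl_on U E `` {a}"
  have in_C: "b \<in> C \<longleftrightarrow> (a, b) \<in> rtrancl_on U E" for b by (simp add: C_def)
  have "(b, c) \<in> rtrancl_on U E" if "b \<in> C" "c \<in> C" for b c
    using that symD[OF s] unfolding in_C by (meson rtrancl_on_trans)
  moreover have "(b, c) \<notin> E" if "b \<in> C" "c \<in> U - C" for b c
    using that unfolding in_C Diff_iff by (meson rtrancl_on_into_rtrancl_on)
  moreover have "C \<subseteq> U" by (auto simp: in_C dest: in_rtrancl_on_in_F)
  moreover have a: "a \<in> C" using assms(2) by (simp add: in_C)
  ultimately have "C \<in> components E U" unfolding components_def by blast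
  then show ?thesis using a by (rule bexI[rotated])
qed

lemma components_disjoint:
  assumes C: "C \<in> components E U" and D: "D \<in> components E U" and a: "a \<in> C" "a \<in> D"
  shows "C = D"
proof -
  have "D \<subseteq> C" if "C \<in> components E U" "D \<in> components E U" "a \<in> C" "a \<in> D" for C D
  proof
    fix b assume "b \<in> D"
    then have "(a, b) \<in> rtrancl_on U E" using that by (auto simp: components_def)
    moreover have "\<forall>a\<in>C. \<forall>b\<in>U - C. (a, b) \<notin> E" using that(1) by (simp add: components_def)
    ultimately show "b \<in> C" using that(3) reach_closed[of a b U E C] by simp
  qed
  then show ?thesis using assms by blast
qed

lemma sccs_verts_induced:
  assumes "pair_graph G" and U: "U \<subseteq> pverts G"
  shows "pre_digraph.sccs_verts (with_proj G \<restriction> U) = components (parcs G) U"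
proof -
  interpret pair_graph G by fact
  have s: "sym (parcs G)" using pair_sym_arcs by (simp add: symmetric_def)
  have "rtrancl_on U (arcs_ends (with_proj G \<restriction> U)) = rtrancl_on U (parcs G)"
  proof (intro subset_antisym subrelI)
    fix a b assume "(a, b) \<in> rtrancl_on U (arcs_ends (with_proj G \<restriction> U))"
    then show "(a, b) \<in> rtrancl_on U (parcs G)"
      by (rule rtrancl_on_mono[rotated 2]) (auto simp: arcs_ends_conv)
  next
    fix a b assume "(a, b) \<in> rtrancl_on U (parcs G)"
    then show "(a, b) \<in> rtrancl_on U (arcs_ends (with_proj G \<restriction> U))"
    proof (induct rule: rtrancl_on_induct)
      case (step y z)
      then have "(y, z) \<in> arcs_ends (with_proj G \<restriction> U)" by (force simp: arcs_ends_conv)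
      with step show ?case by (blast intro: rtrancl_on_into_rtrancl_on)
    qed simp
  qed
  then have r: "u \<rightarrow>\<^sup>*\<^bsub>with_proj G \<restriction> U\<^esub> v \<longleftrightarrow> (u, v) \<in> rtrancl_on U (parcs G)" for u v
    by (simp add: reachable_def)
  have s': "(u, v) \<in> rtrancl_on U (parcs G) \<longleftrightarrow> (v, u) \<in> rtrancl_on U (parcs G)" for u v
    using rtrancl_on_sym[OF s] by (auto dest: symD)
  show ?thesis
    unfolding pre_digraph.sccs_verts_def components_def r
  proof (intro Collect_cong iffI; elim conjE; intro conjI)
    fix S
    assume ne: "S \<noteq> {}" and con: "\<forall>u\<in>S. \<forall>v\<in>S. (u, v) \<in> rtrancl_on U (parcs G)"
    {
      assume mx: "\<forall>u\<in>S. \<forall>v. v \<notin> S \<longrightarrow>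
        (u, v) \<notin> rtrancl_on U (parcs G) \<or> (v, u) \<notin> rtrancl_on U (parcs G)"
      show "S \<subseteq> U" using con by (auto dest: in_rtrancl_on_in_F)
      show "\<forall>a\<in>S. \<forall>b\<in>U - S. (a, b) \<notin> parcs G"
      proof (intro ballI notI)
        fix a b assume ab: "a \<in> S" "b \<in> U - S" "(a, b) \<in> parcs G"
        then have "(a, b) \<in> rtrancl_on U (parcs G)"
          using con by (meson DiffD1 rtrancl_on_into_rtrancl_on)
        then show False using mx s' ab by blast
      qed
    next
      assume "\<forall>a\<in>S. \<forall>b\<in>U - S. (a, b) \<notin> parcs G"
      then show "\<forall>u\<in>S. \<forall>v. v \<notin> S \<longrightarrow>
        (u, v) \<notin> rtrancl_on U (parcs G) \<or> (v, u) \<notin> rtrancl_on U (parcs G)"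
        by (meson reach_closed)
    }
  qed
qed

text \<open>
  A new vertex \<open>t\<close> merges the components that it is adjacent to into one, and leaves the others as they
  are.
\<close>

lemma components_insert:
  assumes s: "sym E" and t: "t \<notin> U"
  defines "D \<equiv> {C \<in> components E U. \<exists>a\<in>C. (t, a) \<in> E}"
  shows "components E (insert t U) = insert (insert t (\<Union>D)) (components E U - D)"
proof -
  let ?R = "rtrancl_on (insert t U) E"
  have trans: "(a, c) \<in> ?R" if "(a, b) \<in> ?R" "(b, c) \<in> ?R" for a b c
    using that by (rule rtrancl_on_trans)
  have symR: "(b, a) \<in> ?R" if "(a, b) \<in> ?R" for a b
    using that rtrancl_on_sym[OF s] by (auto dest: symD)
  have mono: "(a, b) \<in> ?R" if "(a, b) \<in> rtrancl_on U E" for a b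
    using that by (rule rtrancl_on_mono[rotated 2]) auto
  have ft: "(t, a) \<in> ?R" if "a \<in> insert t (\<Union>D)" for a
  proof (cases "a = t")
    case False
    with that obtain C c where C: "C \<in> components E U" "a \<in> C" "c \<in> C" "(t, c) \<in> E"
      by (auto simp: D_def)
    then have "(c, a) \<in> ?R" by (auto simp: components_def intro: mono)
    with C(4) show ?thesis by (auto intro: converse_rtrancl_on_into_rtrancl_on)
  qed simp
  have sub: "C \<subseteq> U" if "C \<in> components E U" for C using that by (auto simp: components_def)
  have cl: "b \<in> C" if "C \<in> components E U" "a \<in> C" "b \<in> U" "(a, b) \<in> E" for a b C
    using that by (auto simp: components_def)
  have new: "insert t (\<Union>D) \<in> components E (insert t U)"
  proof -
    have "(a, b) \<notin> E" if a: "a \<in> insert t (\<Union>D)" and nb: "b \<in> insert t U - insert t (\<Union>D)"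
      for a b
    proof
      assume ab: "(a, b) \<in> E"
      have b: "b \<in> U" using nb by auto
      then obtain C where C: "C \<in> components E U" "b \<in> C" using component_exists[OF s] by blast
      show False
      proof (cases "a = t")
        case True
        then have "C \<in> D" using C ab by (auto simp: D_def)
        then show False using C nb by auto
      next
        case False
        then obtain C' where "C' \<in> D" "a \<in> C'" using a by auto
        then have "b \<in> C'" using cl b ab by (auto simp: D_def)
        then show False using \<open>C' \<in> D\<close> nb by auto
      qed
    qed
    moreover have "insert t (\<Union>D) \<subseteq> insert t U" using sub by (auto simp: D_def)
    moreover have "(a, b) \<in> ?R" if "a \<in> insert t (\<Union>D)" "b \<in> insert t (\<Union>D)" for a b
      using that by (intro trans[OF symR[OF ft] ft])
    ultimately show ?thesis
      unfolding components_def mem_Collect_eq by (intro conjI ballI) auto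
  qed
  have old: "C \<in> components E (insert t U)" if "C \<in> components E U - D" for C
  proof -
    have "(a, t) \<notin> E" if "a \<in> C" for a
      using that \<open>C \<in> components E U - D\<close> s by (auto simp: D_def dest: symD)
    then show ?thesis
      using that unfolding components_def by (auto intro: mono)
  qed
  have "C \<in> insert (insert t (\<Union>D)) (components E U - D)" if C: "C \<in> components E (insert t U)" for C
  proof -
    obtain a where a: "a \<in> C" "a \<in> insert t U" using C by (auto simp: components_def)
    show ?thesis
    proof (cases "a \<in> insert t (\<Union>D)")
      case True
      then show ?thesis using components_disjoint[OF C new a(1)] by auto
    next
      case False
      then obtain C' where "C' \<in> components E U" "a \<in> C'" using component_exists[OF s] a by blast
      then have "C' \<in> components E U - D" using False by auto
      then show ?thesis using components_disjoint[OF C old a(1)] \<open>a \<in> C'\<close> by auto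
    qed
  qed
  then show ?thesis using new old by blast
qed

text \<open>
  \<open>S\<close> and \<open>U - S\<close> are unions of components of the graph on \<open>U\<close>, and \<open>t\<close> has a neighbour in each of
  them. This is a reachability-free way to say that \<open>t\<close> joins different components.
\<close>

definition separates :: "'a rel \<Rightarrow> 'a set \<Rightarrow> 'a \<Rightarrow> 'a set \<Rightarrow> bool" where
  "separates E U t S \<longleftrightarrow> S \<subseteq> U \<and> (\<forall>a\<in>S. \<forall>b\<in>U - S. (a, b) \<notin> E) \<and>
     (\<exists>a\<in>S. (t, a) \<in> E) \<and> (\<exists>b\<in>U - S. (t, b) \<in> E)"

text \<open>
  By the merging above, inserting \<open>t\<close> changes the number of components by \<open>1 - d\<close>, where \<open>d\<close> is the
  number of components adjacent to \<open>t\<close>. So the number drops exactly if \<open>d \<ge> 2\<close>, and then any one of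
  these components serves as \<open>S\<close>.
\<close>

lemma card_components_insert_less:
  assumes s: "sym E" and t: "t \<notin> U" and fin: "finite U"
  shows "card (components E (insert t U)) < card (components E U) \<longleftrightarrow> (\<exists>S. separates E U t S)"
proof -
  define D where "D = {C \<in> components E U. \<exists>a\<in>C. (t, a) \<in> E}"
  have finc: "finite (components E U)"
    by (rule finite_subset[of _ "Pow U"]) (use fin in \<open>auto simp: components_def\<close>)
  have sub: "D \<subseteq> components E U" by (auto simp: D_def)
  have "insert t (\<Union>D) \<notin> components E U - D" using t by (auto simp: components_def)
  then have "card (components E (insert t U)) = Suc (card (components E U - D))"
    unfolding components_insert[OF s t, folded D_def] using finc by simp
  moreover have "card (components E U - D) + card D = card (components E U)"
    using sub finc by (metis card_Diff_subset card_mono finite_subset le_add_diff_inverse2)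
  ultimately have "card (components E (insert t U)) < card (components E U) \<longleftrightarrow> 1 < card D"
    by linarith
  also have "\<dots> \<longleftrightarrow> (\<exists>S. separates E U t S)"
  proof
    assume "1 < card D"
    then have "\<not> (\<forall>C1\<in>D. \<forall>C2\<in>D. C1 = C2)"
      using card_le_Suc0_iff_eq[OF finite_subset[OF sub finc]] by linarith
    then obtain C1 C2 where C: "C1 \<in> D" "C2 \<in> D" "C1 \<noteq> C2" by blast
    then have comp: "C1 \<in> components E U" "C2 \<in> components E U" using sub by auto
    then have "C1 \<inter> C2 = {}" using components_disjoint[OF comp] C(3) by auto
    moreover obtain a b where "a \<in> C1" "(t, a) \<in> E" "b \<in> C2" "(t, b) \<in> E"
      using C by (auto simp: D_def)
    ultimately have "separates E U t C1"
      using comp unfolding separates_def components_def by (intro conjI bexI[of _ a] bexI[of _ b]) auto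
    then show "\<exists>S. separates E U t S" by blast
  next
    assume "\<exists>S. separates E U t S"
    then obtain S a b where S: "S \<subseteq> U" "\<forall>a\<in>S. \<forall>b\<in>U - S. (a, b) \<notin> E"
      and a: "a \<in> S" "(t, a) \<in> E" and b: "b \<in> U - S" "(t, b) \<in> E"
      by (auto simp: separates_def)
    obtain A B where A: "A \<in> components E U" "a \<in> A" and B: "B \<in> components E U" "b \<in> B"
      using component_exists[OF s, of a U] component_exists[OF s, of b U] S(1) a b by blast
    have "A \<subseteq> S"
    proof
      fix c assume "c \<in> A"
      then have "(a, c) \<in> rtrancl_on U E" using A by (auto simp: components_def)
      then show "c \<in> S" using a(1) S(2) by (rule reach_closed)
    qed
    then have "A \<noteq> B" using B b by blast
    moreover have "A \<in> D" "B \<in> D" using A B a b by (auto simp: D_def)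
    ultimately show "1 < card D"
      using card_le_Suc0_iff_eq[OF finite_subset[OF sub finc]] by (auto simp flip: not_le)
  qed
  finally show ?thesis .
qed

lemma cut_sets_iff_separates:
  assumes "pair_graph G"
  shows "T \<in> cut_sets (with_proj G) \<longleftrightarrow> T \<subseteq> pverts G \<and>
    (\<forall>t\<in>T. \<exists>S. separates (parcs G) (pverts G - T) t S)"
proof -
  interpret pair_graph G by fact
  have s: "sym (parcs G)" using pair_sym_arcs by (simp add: symmetric_def)
  have cc: "cut_count (with_proj G) T = card (components (parcs G) (pverts G - T))" for T
    by (simp add: cut_count_def num_components_def sccs_verts_induced[OF assms])
  have "cut_count (with_proj G) (T - {t}) < cut_count (with_proj G) T \<longleftrightarrow>
      (\<exists>S. separates (parcs G) (pverts G - T) t S)" if "t \<in> T" "T \<subseteq> pverts G" for t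
  proof -
    have e: "pverts G - (T - {t}) = insert t (pverts G - T)" using that by auto
    show ?thesis
      unfolding cc e using that s pair_finite_verts by (intro card_components_insert_less) simp_all
  qed
  then show ?thesis by (auto simp: cut_sets_def cut_point_property_def)
qed

lemma separates_complement:
  assumes "sym E" "separates E U t S"
  shows "separates E U t (U - S)"
  using assms unfolding separates_def by (auto dest: symD)

section \<open>Bipartite 2-regular graphs without short cycles\<close>

text \<open>
  The assumptions say that \<open>F\<close> is a disjoint union of even cycles of length at least \<open>8\<close>, with at least
  five vertices on each side of the bipartition. They are symmetric in \<open>X\<close> and \<open>Y\<close>, so
  every fact also holds with the sides exchanged. The 6-cycle condition is stated from \<open>X\<close> only, since
  every 6-cycle can be traversed starting there.
\<close>

locale long_even_cycles =
  fixes X Y :: "'a set" and F :: "'a rel"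
  assumes disj: "X \<inter> Y = {}"
    and finX: "finite X" and finY: "finite Y"
    and cardX: "card X \<ge> 5" and cardY: "card Y \<ge> 5"
    and F_sub: "F \<subseteq> X \<times> Y \<union> Y \<times> X"
    and F_sym: "sym F"
    and F_deg: "a \<in> X \<union> Y \<Longrightarrow> card (F `` {a}) = 2"
    and no_C4: "\<lbrakk>a \<noteq> b; p \<noteq> q; (a, p) \<in> F; (p, b) \<in> F; (b, q) \<in> F; (q, a) \<in> F\<rbrakk> \<Longrightarrow> False"
    and no_C6: "\<lbrakk>a \<noteq> b; b \<noteq> c; c \<noteq> a; p \<noteq> q; q \<noteq> r; r \<noteq> p; a \<in> X; b \<in> X; c \<in> X;
      (a, p) \<in> F; (p, b) \<in> F; (b, q) \<in> F; (q, c) \<in> F; (c, r) \<in> F; (r, a) \<in> F\<rbrakk> \<Longrightarrow> False"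
begin

abbreviation N :: "'a \<Rightarrow> 'a set" where
  "N a \<equiv> F `` {a}"

text \<open>The bipartite complement of \<open>F\<close>, in which cut sets are considered.\<close>

definition E :: "'a rel" where
  "E = (X \<times> Y \<union> Y \<times> X) - F"

lemma F_symD: "(a, b) \<in> F \<Longrightarrow> (b, a) \<in> F"
  using F_sym by (rule symD)

lemma sym_E: "sym E"
  using F_symD by (auto simp: E_def sym_def)

lemma swap: "long_even_cycles Y X F"
proof
  show "\<lbrakk>a \<noteq> b; b \<noteq> c; c \<noteq> a; p \<noteq> q; q \<noteq> r; r \<noteq> p; a \<in> Y; b \<in> Y; c \<in> Y;
      (a, p) \<in> F; (p, b) \<in> F; (b, q) \<in> F; (q, c) \<in> F; (c, r) \<in> F; (r, a) \<in> F\<rbrakk> \<Longrightarrow> False"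
    for a b c p q r
    using no_C6[of p q r b c a] F_sub disj by blast
qed (use disj finX finY cardX cardY F_sub F_sym F_deg no_C4 in auto)

lemma E_swap: "long_even_cycles.E Y X F = E"
  unfolding long_even_cycles.E_def[OF swap] E_def by auto

lemma N_X: "x \<in> X \<Longrightarrow> N x \<subseteq> Y" and N_Y: "y \<in> Y \<Longrightarrow> N y \<subseteq> X"
  using F_sub disj by blast+

lemma finite_N: "a \<in> X \<union> Y \<Longrightarrow> finite (N a)"
  using F_deg by (metis card.infinite zero_neq_numeral)

lemma N_pair:
  assumes "a \<in> X \<union> Y"
  obtains p q where "p \<noteq> q" "N a = {p, q}"
  using F_deg[OF assms] by (meson card_2_iff)

text \<open>Two vertices with the same neighbourhood would lie on a 4-cycle.\<close>

lemma N_other: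
  assumes "a \<in> X \<union> Y" "a \<noteq> b"
  obtains p where "p \<in> N a" "(b, p) \<notin> F"
proof -
  obtain p q where pq: "p \<noteq> q" "N a = {p, q}" using N_pair[OF assms(1)] .
  then have "(b, p) \<notin> F \<or> (b, q) \<notin> F"
    using no_C4[of a b p q] assms(2) F_symD by blast
  then show thesis using that pq by blast
qed

text \<open>
  The basic consequence of a split: there is no edge of the complement across it, so all pairs across
  it that lie on opposite sides of the bipartition are in \<open>F\<close>.
\<close>

lemma separated_imp_F:
  assumes "separates E U t S" "U \<subseteq> X \<union> Y"
  shows "\<lbrakk>a \<in> S; b \<in> U - S; a \<in> X \<and> b \<in> Y \<or> a \<in> Y \<and> b \<in> X\<rbrakk> \<Longrightarrow> (a, b) \<in> F \<and> (b, a) \<in> F"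
  using assms F_symD unfolding separates_def E_def by blast

section \<open>The remainders of cut sets\<close>

text \<open>
  If the part \<open>U - S\<close> lay within \<open>X\<close>, its vertices would be \<open>F\<close>-adjacent to all of \<open>U \<inter> Y\<close>, hence have
  degree at least \<open>3\<close>.
\<close>

lemma separates_meets_Y:
  assumes sep: "separates E U t S" and U: "U \<subseteq> X \<union> Y" and card: "card (U \<inter> Y) \<ge> 3"
  shows "(U - S) \<inter> Y \<noteq> {}"
proof
  assume *: "(U - S) \<inter> Y = {}"
  obtain x where x: "x \<in> U - S" using sep by (auto simp: separates_def)
  then have xX: "x \<in> X" using * U by blast
  have "U \<inter> Y \<subseteq> N x"
    using separated_imp_F[OF sep U] x xX * by blast
  then have "card (U \<inter> Y) \<le> 2"
    using F_deg[of x] card_mono[OF finite_N[of x]] xX by auto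
  then show False using card by simp
qed

lemma separates_Y_in_N:
  assumes sep: "separates E U t S" and U: "U \<subseteq> X \<union> Y" and x: "x \<in> (U - S) \<inter> X"
  shows "S \<inter> Y \<subseteq> N x"
  using separated_imp_F[OF sep U] x by blast

lemma separates_card_Y:
  assumes sep: "separates E U t S" and U: "U \<subseteq> X \<union> Y" and ne: "(U - S) \<inter> X \<noteq> {}"
  shows "card (S \<inter> Y) \<le> 2"
proof -
  obtain x where x: "x \<in> (U - S) \<inter> X" using ne by blast
  then show ?thesis
    using F_deg[of x] card_mono[OF finite_N[of x] separates_Y_in_N[OF sep U x]] by auto
qed

text \<open>
  Two vertices of \<open>S \<inter> X\<close> and two vertices of \<open>(U - S) \<inter> Y\<close> would form a 4-cycle of \<open>F\<close>.
\<close>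

lemma separates_card_mixed:
  assumes sep: "separates E U t S" and U: "U \<subseteq> X \<union> Y" and two: "card (S \<inter> X) = 2"
  shows "card ((U - S) \<inter> Y) \<le> 1"
proof -
  obtain a b where ab: "a \<noteq> b" "S \<inter> X = {a, b}" using two by (meson card_2_iff)
  have "p = q" if "p \<in> (U - S) \<inter> Y" "q \<in> (U - S) \<inter> Y" for p q
  proof (rule ccontr)
    assume "p \<noteq> q"
    have "a \<in> S" "b \<in> S" "a \<in> X" "b \<in> X" using ab by auto
    then have "(a, p) \<in> F" "(p, b) \<in> F" "(b, q) \<in> F" "(q, a) \<in> F"
      using separated_imp_F[OF sep U] that by auto
    then show False using no_C4 ab \<open>p \<noteq> q\<close> by blast
  qed
  moreover have "finite ((U - S) \<inter> Y)" using finY by auto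
  ultimately show ?thesis using card_le_Suc0_iff_eq[of "(U - S) \<inter> Y"] by auto
qed

text \<open>
  The four parts cut out by the split and the bipartition are nonempty and have at most two elements.
  As \<open>S \<inter> X\<close> has two elements, the absence of 4-cycles forces \<open>(U - S) \<inter> Y\<close> to be a single vertex \<open>y\<close>,
  hence \<open>S \<inter> Y\<close> has two elements, hence \<open>(U - S) \<inter> X\<close> is a single vertex \<open>x\<close>. Being of degree
  \<open>2\<close>, the vertices \<open>x\<close> and \<open>y\<close> have \<open>S \<inter> Y\<close> and \<open>S \<inter> X\<close> as their neighbourhoods.
\<close>

lemma separated_large_aux:
  assumes sep: "separates E U t S" and U: "U \<subseteq> X \<union> Y"
    and X3: "card (U \<inter> X) \<ge> 3" and Y3: "card (U \<inter> Y) \<ge> 3" and two: "card (S \<inter> X) = 2"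
  shows "\<exists>x\<in>X. \<exists>y\<in>Y. (x, y) \<notin> F \<and> U = {x, y} \<union> N x \<union> N y"
proof -
  interpret sw: long_even_cycles Y X F by (rule swap)
  note [simp] = E_swap
  have U': "U \<subseteq> Y \<union> X" using U by blast
  have SU: "S \<subseteq> U" using sep by (simp add: separates_def)
  have fin: "finite U" using U finX finY by (meson finite_UnI finite_subset)
  have split: "card (U \<inter> W) = card (S \<inter> W) + card ((U - S) \<inter> W)" for W
  proof -
    have "U \<inter> W = (S \<inter> W) \<union> ((U - S) \<inter> W)" using SU by blast
    then show ?thesis using fin SU
      by (metis (no_types, lifting) Diff_disjoint card_Un_disjoint finite_Int inf_assoc inf_bot_left
          inf_commute infinite_super Diff_subset)
  qed
  have BY: "card ((U - S) \<inter> Y) = 1"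
  proof -
    have "(U - S) \<inter> Y \<noteq> {}" using separates_meets_Y[OF sep U Y3] .
    then have "card ((U - S) \<inter> Y) \<noteq> 0" using finY by simp
    then show ?thesis using separates_card_mixed[OF sep U two] by linarith
  qed
  have BX_ne: "(U - S) \<inter> X \<noteq> {}" using sw.separates_meets_Y[of U t S] sep U' X3 by simp
  have AY: "card (S \<inter> Y) = 2"
    using separates_card_Y[OF sep U BX_ne] split[of Y] BY Y3 by linarith
  have BX: "card ((U - S) \<inter> X) = 1"
    using sw.separates_card_mixed[of U t S] sep U' AY split[of X] two X3 by simp
  obtain x where x: "(U - S) \<inter> X = {x}" using BX by (auto simp: card_1_singleton_iff)
  obtain y where y: "(U - S) \<inter> Y = {y}" using BY by (auto simp: card_1_singleton_iff)
  have xX: "x \<in> X" and yY: "y \<in> Y" using x y by auto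
  have "S \<inter> Y \<subseteq> N x" using separates_Y_in_N[OF sep U] x by auto
  then have Nx: "S \<inter> Y = N x"
    using AY F_deg[of x] finite_N[of x] xX by (intro card_subset_eq) auto
  have "S \<inter> X \<subseteq> N y" using sw.separates_Y_in_N[of U t S y] sep U' y by auto
  then have Ny: "S \<inter> X = N y"
    using two F_deg[of y] finite_N[of y] yY by (intro card_subset_eq) auto
  have "U = (U - S) \<inter> X \<union> (U - S) \<inter> Y \<union> S \<inter> Y \<union> S \<inter> X" using U SU by blast
  then have "U = {x} \<union> {y} \<union> N x \<union> N y" unfolding x y Nx Ny .
  moreover have "(x, y) \<notin> F" using Nx y by auto
  ultimately show ?thesis using xX yY by auto
qed

text \<open>
  One of the two parts has two elements in \<open>X\<close>, and the situation is symmetric under exchanging the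
  parts.
\<close>

lemma separated_large:
  assumes sep: "separates E U t S" and U: "U \<subseteq> X \<union> Y"
    and X3: "card (U \<inter> X) \<ge> 3" and Y3: "card (U \<inter> Y) \<ge> 3"
  shows "\<exists>x\<in>X. \<exists>y\<in>Y. (x, y) \<notin> F \<and> U = {x, y} \<union> N x \<union> N y"
proof -
  interpret sw: long_even_cycles Y X F by (rule swap)
  note [simp] = E_swap
  have U': "U \<subseteq> Y \<union> X" using U by blast
  have SU: "S \<subseteq> U" using sep by (simp add: separates_def)
  have sep': "separates E U t (U - S)" using separates_complement[OF sym_E sep] .
  have "card (S \<inter> X) \<le> 2"
    using sw.separates_card_Y[of U t S] separates_meets_Y[OF sep U Y3] sep U' by simp
  moreover have "card ((U - S) \<inter> X) \<le> 2"
    using sw.separates_card_Y[of U t "U - S"] separates_meets_Y[OF sep' U Y3] sep' U' by simp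
  moreover have "card (U \<inter> X) \<le> card (S \<inter> X) + card ((U - S) \<inter> X)"
  proof -
    have "U \<inter> X = (S \<inter> X) \<union> ((U - S) \<inter> X)" using SU by blast
    then show ?thesis by (metis card_Un_le)
  qed
  ultimately consider "card (S \<inter> X) = 2" | "card ((U - S) \<inter> X) = 2" using X3 by linarith
  then show ?thesis
    using separated_large_aux[OF sep U X3 Y3] separated_large_aux[OF sep' U X3 Y3] by cases
qed

text \<open>
  A vertex \<open>t\<close> of \<open>X\<close> has all its neighbours in \<open>Y\<close>, and needs one in each part.
\<close>

lemma separates_card_Y_ge_2:
  assumes sep: "separates E U t S" and U: "U \<subseteq> X \<union> Y" and t: "t \<in> X"
  shows "card (U \<inter> Y) \<ge> 2"
proof -
  obtain a b where ab: "a \<in> S" "b \<in> U - S" "(t, a) \<in> E" "(t, b) \<in> E" "S \<subseteq> U"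
    using sep by (auto simp: separates_def)
  then have "{a, b} \<subseteq> U \<inter> Y" using t disj by (auto simp: E_def)
  moreover have "a \<noteq> b" using ab by blast
  then have "card {a, b} = 2" by simp
  ultimately show ?thesis using finY by (metis card_mono finite_Int)
qed

text \<open>
  Let \<open>U \<inter> Y = {a, b}\<close>. If \<open>a\<close> and \<open>b\<close> are in different parts of a split, then every vertex of \<open>U \<inter> X\<close> is
  \<open>F\<close>-adjacent to \<open>a\<close> or \<open>b\<close>. A deleted vertex of \<open>X\<close> sees both parts only through \<open>a\<close> and \<open>b\<close>, so it
  puts them in different parts and is itself \<open>F\<close>-adjacent to neither; this gives two stars. If no vertex
  of \<open>X\<close> is deleted, then \<open>|X| \<ge> 5\<close> keeps \<open>a\<close> and \<open>b\<close> together, and the other part consists of a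
  common \<open>F\<close>-neighbour of both.
\<close>

lemma separated_two:
  assumes sep: "\<forall>t\<in>X \<union> Y - U. \<exists>S. separates E U t S" and U: "U \<subset> X \<union> Y"
    and two: "card (U \<inter> Y) = 2"
  shows "(\<exists>x\<in>X. U = X \<union> N x) \<or>
    (\<exists>a b. a \<in> X \<union> Y \<and> b \<in> X \<union> Y \<and> a \<noteq> b \<and> (a, b) \<notin> F \<and> U = {a, b} \<union> N a \<union> N b)"
proof -
  obtain a b where ab: "a \<noteq> b" "U \<inter> Y = {a, b}" using two by (meson card_2_iff)
  then have Y: "a \<in> Y" "b \<in> Y" by auto
  have U': "U \<subseteq> X \<union> Y" using U by auto
  have nab: "(a, b) \<notin> F" using Y F_sub disj by blast
  have cover: "U \<inter> X \<subseteq> N a \<union> N b" if "separates E U t S" "a \<in> S \<longleftrightarrow> b \<notin> S" for t S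
  proof
    fix x assume x: "x \<in> U \<inter> X"
    have "a \<in> U" "b \<in> U" "S \<subseteq> U" using ab that by (auto simp: separates_def)
    then show "x \<in> N a \<union> N b"
      using separated_imp_F[OF that(1) U', of x a] separated_imp_F[OF that(1) U', of a x]
        separated_imp_F[OF that(1) U', of x b] separated_imp_F[OF that(1) U', of b x]
        that(2) x Y by blast
  qed
  show ?thesis
  proof (cases "X \<subseteq> U")
    case True
    then have UX: "U = X \<union> {a, b}" using ab U by blast
    obtain t where "t \<in> X \<union> Y - U" using U by blast
    then obtain S0 where S0: "separates E U t S0" using sep by blast
    \<comment> \<open>Exchanging the parts if necessary, \<open>a\<close> lies in \<open>S\<close>.\<close>
    define S where "S = (if a \<in> S0 then S0 else U - S0)"
    have S: "separates E U t S" using S0 separates_complement[OF sym_E S0] by (simp add: S_def)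
    have aS: "a \<in> S" using ab by (auto simp: S_def)
    have "b \<in> S"
    proof (rule ccontr)
      assume "b \<notin> S"
      then have "X \<subseteq> N a \<union> N b" using cover[OF S] aS True by blast
      then have "card X \<le> card (N a \<union> N b)" using Y finite_N by (intro card_mono) auto
      also have "\<dots> \<le> card (N a) + card (N b)" by (rule card_Un_le)
      finally show False using F_deg Y cardX by simp
    qed
    obtain x where x: "x \<in> U - S" using S by (auto simp: separates_def)
    then have xX: "x \<in> X" using UX aS \<open>b \<in> S\<close> by blast
    then have "{a, b} \<subseteq> N x"
      using separated_imp_F[OF S U', of a x] separated_imp_F[OF S U', of b x] aS \<open>b \<in> S\<close> x Y by blast
    then have "{a, b} = N x"
      using F_deg[of x] finite_N[of x] ab xX by (intro card_subset_eq) auto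
    then show ?thesis using UX xX by blast
  next
    case False
    \<comment> \<open>Some vertex of \<open>X\<close> is deleted, and any such vertex separates \<open>a\<close> from \<open>b\<close>.\<close>
    have out: "(t, a) \<in> E \<and> (t, b) \<in> E \<and> U \<inter> X \<subseteq> N a \<union> N b" if t: "t \<in> X - U" for t
    proof -
      obtain S where S: "separates E U t S" using sep t by blast
      then obtain p q where pq: "p \<in> S" "q \<in> U - S" "(t, p) \<in> E" "(t, q) \<in> E" "S \<subseteq> U"
        by (auto simp: separates_def)
      then have "p \<in> U \<inter> Y" "q \<in> U \<inter> Y" using t disj by (auto simp: E_def)
      then have "p = a \<and> q = b \<or> p = b \<and> q = a" using pq ab by auto
      then show ?thesis using pq cover[OF S] by auto
    qed
    have "N a \<union> N b \<subseteq> U \<inter> X"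
    proof
      fix x assume x: "x \<in> N a \<union> N b"
      then have "x \<in> X" using Y N_Y by blast
      moreover have "\<not> ((x, a) \<in> E \<and> (x, b) \<in> E)" using x F_symD by (auto simp: E_def)
      ultimately show "x \<in> U \<inter> X" using out[of x] by auto
    qed
    moreover have "U \<inter> X \<subseteq> N a \<union> N b" using False out by blast
    ultimately have "U \<inter> X = N a \<union> N b" by blast
    then have "U = {a, b} \<union> N a \<union> N b" using ab U' by blast
    then show ?thesis using ab Y nab by blast
  qed
qed

text \<open>
  In \<open>F\<close> the closed neighbourhoods of \<open>a\<close> and \<open>b\<close> are stars with two leaves; they may share a leaf, or be
  joined by an edge between leaves.
\<close>

definition two_stars :: "'a \<Rightarrow> 'a \<Rightarrow> 'a set \<Rightarrow> bool" where
  "two_stars a b U \<longleftrightarrow> a \<in> X \<union> Y \<and> b \<in> X \<union> Y \<and> a \<noteq> b \<and> (a, b) \<notin> F \<and> U = {a, b} \<union> N a \<union> N b"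

lemma two_stars_swap: "long_even_cycles.two_stars Y X F a b U = two_stars a b U"
  unfolding long_even_cycles.two_stars_def[OF swap] two_stars_def by auto

text \<open>
  The sets \<open>U\<close> that remain after deletion of a nonempty cut set. The pairs of cyclically consecutive
  vertices occur here as the neighbourhoods \<open>N x\<close>.
\<close>

definition admissible_remainder :: "'a set \<Rightarrow> bool" where
  "admissible_remainder U \<longleftrightarrow> U = X \<or> U = Y \<or> (\<exists>y\<in>Y. U = X \<union> {y}) \<or> (\<exists>x\<in>X. U = Y \<union> {x}) \<or>
    (\<exists>x\<in>X. U = X \<union> N x) \<or> (\<exists>y\<in>Y. U = Y \<union> N y) \<or>
    (\<exists>a b. two_stars a b U)"

lemma admissible_remainder_swap: "long_even_cycles.admissible_remainder Y X F U = admissible_remainder U"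
  unfolding long_even_cycles.admissible_remainder_def[OF swap] admissible_remainder_def two_stars_swap by blast

lemma separated_few_Y:
  assumes sep: "\<forall>t\<in>X \<union> Y - U. \<exists>S. separates E U t S" and U: "U \<subset> X \<union> Y"
    and few: "card (U \<inter> Y) \<le> 2"
  shows "admissible_remainder U"
proof (cases "card (U \<inter> Y) = 2")
  case True
  then show ?thesis using separated_two[OF sep U] by (auto simp: admissible_remainder_def two_stars_def)
next
  case False
  have XU: "X \<subseteq> U"
  proof
    fix x assume x: "x \<in> X"
    show "x \<in> U"
    proof (rule ccontr)
      assume "x \<notin> U"
      then obtain S where "separates E U x S" using sep x by blast
      then show False using separates_card_Y_ge_2[of U x S] x U few False by auto
    qed
  qed
  consider "card (U \<inter> Y) = 0" | "card (U \<inter> Y) = 1" using few False by linarith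
  then show ?thesis
  proof cases
    case 1
    then have "U \<inter> Y = {}" using finY by simp
    then have "U = X" using XU U by blast
    then show ?thesis by (simp add: admissible_remainder_def)
  next
    case 2
    then obtain y where "U \<inter> Y = {y}" by (auto simp: card_1_singleton_iff)
    then have "U = X \<union> {y}" "y \<in> Y" using XU U by blast+
    then show ?thesis by (auto simp: admissible_remainder_def)
  qed
qed

lemma separated_imp_admissible:
  assumes sep: "\<forall>t\<in>X \<union> Y - U. \<exists>S. separates E U t S" and U: "U \<subset> X \<union> Y"
  shows "admissible_remainder U"
proof -
  interpret sw: long_even_cycles Y X F by (rule swap)
  consider "card (U \<inter> Y) \<le> 2" | "card (U \<inter> X) \<le> 2" | "card (U \<inter> X) \<ge> 3" "card (U \<inter> Y) \<ge> 3"
    by linarith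
  then show ?thesis
  proof cases
    case 1
    then show ?thesis using separated_few_Y[OF sep U] by blast
  next
    case 2
    then show ?thesis
      using sw.separated_few_Y[of U] sep U unfolding E_swap admissible_remainder_swap by (simp add: Un_commute)
  next
    case 3
    obtain t S where S: "separates E U t S" using U sep by blast
    obtain x y where xy: "x \<in> X" "y \<in> Y" "(x, y) \<notin> F" "U = {x, y} \<union> N x \<union> N y"
      using separated_large[OF S _ 3] U by blast
    moreover have "x \<noteq> y" using xy disj by blast
    ultimately show ?thesis unfolding admissible_remainder_def two_stars_def by blast
  qed
qed

section \<open>Separations of the admissible remainders\<close>

text \<open>A vertex has at most two non-neighbours in the complement on the opposite side.\<close>

lemma E_neighbour_exists:
  assumes "t \<in> Y" "W \<subseteq> X" "card W \<ge> 3"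
  obtains w where "w \<in> W" "(t, w) \<in> E"
proof -
  have "\<not> W \<subseteq> N t"
  proof
    assume "W \<subseteq> N t"
    then have "card W \<le> card (N t)" using assms(1) finite_N by (intro card_mono) auto
    then show False using assms(1,3) F_deg[of t] by simp
  qed
  then show thesis using that assms(1,2) by (auto simp: E_def)
qed

text \<open>
  The vertex \<open>x\<close> is isolated in the complement on \<open>U\<close>. If \<open>t\<close> sees it, then \<open>{x}\<close> is a suitable part,
  because \<open>t\<close> certainly sees another vertex of \<open>X\<close>.
\<close>

lemma separates_isolated:
  assumes t: "t \<in> Y" and x: "x \<in> X" "(t, x) \<in> E" and U: "X \<subseteq> U" "U \<inter> Y \<subseteq> N x"
    and UV: "U \<subseteq> X \<union> Y"
  shows "separates E U t {x}"
proof -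
  have "card (X - {x}) \<ge> 3" using cardX finX x by simp
  then obtain w where "w \<in> X - {x}" "(t, w) \<in> E"
    using E_neighbour_exists[OF t, of "X - {x}"] by blast
  moreover have "(x, b) \<notin> E" if "b \<in> U - {x}" for b
    using that U UV x disj by (auto simp: E_def)
  ultimately show ?thesis using U x unfolding separates_def by blast
qed

lemma separated_X:
  assumes "t \<in> Y"
  shows "\<exists>S. separates E X t S"
proof -
  obtain x where "x \<in> X" "(t, x) \<in> E"
    using E_neighbour_exists[OF assms, of X] cardX by auto
  then show ?thesis using separates_isolated[OF assms, of x X] disj by auto
qed

lemma separated_X_vertex:
  assumes "t \<in> Y" "y \<in> Y" "t \<noteq> y"
  shows "\<exists>S. separates E (X \<union> {y}) t S"
proof -
  obtain x where x: "x \<in> N y" "(t, x) \<notin> F" using N_other[of y t] assms by auto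
  then have "x \<in> X" "(x, y) \<in> F" using N_Y assms F_symD by auto
  then have "separates E (X \<union> {y}) t {x}"
    using x assms disj by (intro separates_isolated) (auto simp: E_def)
  then show ?thesis by blast
qed

lemma separated_X_neighbours:
  assumes "t \<in> Y - N x" "x \<in> X"
  shows "\<exists>S. separates E (X \<union> N x) t S"
proof -
  have "(t, x) \<in> E" using assms F_symD by (auto simp: E_def)
  then have "separates E (X \<union> N x) t {x}"
    using assms disj N_X[of x] by (intro separates_isolated) auto
  then show ?thesis by blast
qed

text \<open>
  Here \<open>{a, b}\<close> is one part of the split, and the four leaves of the stars are the other.
\<close>

lemma separated_opposite:
  assumes ab: "a \<in> X" "b \<in> Y" "(a, b) \<notin> F" and U: "U = {a, b} \<union> N a \<union> N b" and t: "t \<in> X - U"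
  shows "\<exists>S. separates E U t S"
proof -
  obtain p where p: "p \<in> N a" "(t, p) \<notin> F" using N_other[of a t] ab t U by auto
  have Na: "N a \<subseteq> Y" and Nb: "N b \<subseteq> X" using ab N_X N_Y by auto
  have nba: "(b, a) \<notin> F" using ab F_symD by blast
  have tb: "(t, b) \<in> E" using t U ab F_symD by (auto simp: E_def)
  have tp: "(t, p) \<in> E" using t p Na by (auto simp: E_def)
  have "p \<noteq> a" "p \<noteq> b" using p Na ab disj by auto
  then have pU: "p \<in> U - {a, b}" using p U by auto
  have "(c, d) \<notin> E" if "c \<in> {a, b}" "d \<in> U - {a, b}" for c d
    using that U Na Nb ab disj by (auto simp: E_def)
  then have "separates E U t {a, b}"
    unfolding separates_def using tb tp pU U by blast
  then show ?thesis by blast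
qed

text \<open>
  Each centre is grouped with the leaves of the other star. This split may fail for a deleted \<open>t\<close> only if
  the stars share a leaf \<open>x\<close> and \<open>t\<close> is on the side of the centres. Then \<open>x\<close> is isolated in the
  complement, so \<open>{x}\<close> can be taken as a part; a vertex \<open>t\<close> that sees neither of the remaining leaves
  \<open>p\<close> and \<open>q\<close> would close the 6-cycle \<open>x a p t q b\<close>.
\<close>

lemma separated_same_side:
  assumes ab: "a \<in> Y" "b \<in> Y" "a \<noteq> b" and U: "U = {a, b} \<union> N a \<union> N b" and t: "t \<in> X \<union> Y - U"
  shows "\<exists>S. separates E U t S"
proof -
  have Na: "N a \<subseteq> X" and Nb: "N b \<subseteq> X" using ab N_Y by auto
  define S where "S = {a} \<union> (N b - N a)"
  have US: "U - S = {b} \<union> N a" using U ab Na Nb disj by (auto simp: S_def)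
  have SU: "S \<subseteq> U" using U by (auto simp: S_def)
  have closed: "\<forall>c\<in>S. \<forall>d\<in>U - S. (c, d) \<notin> E"
    unfolding US using ab Na Nb disj F_symD by (auto simp: S_def E_def)
  show ?thesis
  proof (cases "t \<in> X")
    case True
    then have "(t, a) \<in> E" "(t, b) \<in> E" using t U ab F_symD by (auto simp: E_def)
    moreover have "a \<in> S" by (simp add: S_def)
    moreover have "b \<in> U - S" unfolding US by simp
    ultimately have "separates E U t S"
      unfolding separates_def using closed SU by blast
    then show ?thesis by blast
  next
    case False
    then have tY: "t \<in> Y" "t \<noteq> a" "t \<noteq> b" using t U by auto
    show ?thesis
    proof (cases "N a \<inter> N b = {}")
      case True
      obtain p where p: "p \<in> N a" "(t, p) \<notin> F" using N_other[of a t] ab tY by auto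
      obtain q where q: "q \<in> N b" "(t, q) \<notin> F" using N_other[of b t] ab tY by auto
      have "(t, p) \<in> E" "(t, q) \<in> E" using p q tY Na Nb by (auto simp: E_def)
      moreover have "p \<in> U - S" unfolding US using p by simp
      moreover have "q \<in> S" using q True by (auto simp: S_def)
      ultimately have "separates E U t S"
        unfolding separates_def using closed SU by blast
      then show ?thesis by blast
    next
      case False
      then obtain x where x: "x \<in> N a" "x \<in> N b" by blast
      then have xX: "x \<in> X" using Na by blast
      have "{a, b} \<subseteq> N x" using x F_symD by auto
      then have Nx: "{a, b} = N x"
        using F_deg[of x] finite_N[of x] ab xX by (intro card_subset_eq) auto
      obtain p where p: "p \<in> N a" "p \<noteq> x"
        using N_pair[of a] ab by (metis UnCI insertCI)
      obtain q where q: "q \<in> N b" "q \<noteq> x"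
        using N_pair[of b] ab by (metis UnCI insertCI)
      have "p \<noteq> q" using no_C4[of a b x p] x p q ab F_symD by blast
      have "(t, p) \<notin> F \<or> (t, q) \<notin> F"
        using no_C6[of x p q a t b] p q x \<open>p \<noteq> q\<close> tY ab xX Na Nb F_symD by blast
      then obtain w where w: "w \<in> N a \<union> N b" "w \<noteq> x" "(t, w) \<notin> F" using p q by blast
      have "(t, w) \<in> E" using w tY Na Nb by (auto simp: E_def)
      moreover have "(t, x) \<in> E" using Nx tY xX F_symD by (auto simp: E_def)
      moreover have "(x, d) \<notin> E" if "d \<in> U - {x}" for d
        using that U Nx Na Nb xX disj by (auto simp: E_def)
      moreover have "x \<in> U" "w \<in> U - {x}" using x w U by auto
      ultimately have "separates E U t {x}"
        unfolding separates_def by blast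
      then show ?thesis by blast
    qed
  qed
qed

lemma admissible_imp_separated:
  assumes "admissible_remainder U" and t: "t \<in> X \<union> Y - U"
  shows "\<exists>S. separates E U t S"
proof -
  interpret sw: long_even_cycles Y X F by (rule swap)
  note sw_sep = sw.separated_X sw.separated_X_vertex sw.separated_X_neighbours
    sw.separated_opposite sw.separated_same_side
  note sw_sep = sw_sep[unfolded E_swap]
  show ?thesis
    using assms(1) unfolding admissible_remainder_def two_stars_def
  proof (elim disjE bexE exE conjE)
    assume "U = X"
    then show ?thesis using separated_X t by auto
  next
    assume "U = Y"
    then show ?thesis using sw_sep(1) t by auto
  next
    fix y assume "y \<in> Y" "U = X \<union> {y}"
    then show ?thesis using separated_X_vertex[of t y] t by auto
  next
    fix x assume "x \<in> X" "U = Y \<union> {x}"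
    then show ?thesis using sw_sep(2)[of t x] t by auto
  next
    fix x assume "x \<in> X" "U = X \<union> N x"
    then show ?thesis using separated_X_neighbours[of t x] t by auto
  next
    fix y assume "y \<in> Y" "U = Y \<union> N y"
    then show ?thesis using sw_sep(3)[of t y] t by auto
  next
    fix a b assume ab: "a \<in> X \<union> Y" "b \<in> X \<union> Y" "a \<noteq> b" "(a, b) \<notin> F"
      and U: "U = {a, b} \<union> N a \<union> N b"
    have U': "U = {b, a} \<union> N b \<union> N a" using U by blast
    have nba: "(b, a) \<notin> F" using ab F_symD by blast
    have t': "t \<in> Y \<union> X - U" using t by blast
    have opposite: ?thesis if "x \<in> X" "y \<in> Y" "(x, y) \<notin> F" "(y, x) \<notin> F"
      "U = {x, y} \<union> N x \<union> N y" "U = {y, x} \<union> N y \<union> N x" for x y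
      using separated_opposite[OF that(1,2,3,5)] sw_sep(4)[OF that(2,1,4,6)] t by blast
    consider "a \<in> X" "b \<in> X" | "a \<in> Y" "b \<in> Y" | "a \<in> X" "b \<in> Y" | "a \<in> Y" "b \<in> X"
      using ab(1,2) by auto
    then show ?thesis
    proof cases
      case 1
      show ?thesis using sw_sep(5)[OF 1 ab(3) U t'] .
    next
      case 2
      show ?thesis using separated_same_side[OF 2 ab(3) U t] .
    next
      case 3
      show ?thesis using opposite[OF 3 ab(4) nba U U'] .
    next
      case 4
      show ?thesis using opposite[OF 4(2,1) nba ab(4) U' U] .
    qed
  qed
qed

lemma separated_iff_admissible:
  assumes "U \<subset> X \<union> Y"
  shows "(\<forall>t\<in>X \<union> Y - U. \<exists>S. separates E U t S) \<longleftrightarrow> admissible_remainder U"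
  using separated_imp_admissible[OF _ assms] admissible_imp_separated by blast

end

section \<open>Isomorphisms as induced copies\<close>

text \<open>
  An isomorphism from \<open>H\<close> onto the induced subgraph of \<open>F\<close> on \<open>U\<close>, as a bare map on vertices. It goes
  from the model graph to \<open>U\<close>, so that the vertices of \<open>U\<close> can be named by those of the model.
\<close>

definition induced_copy :: "'a rel \<Rightarrow> 'b pair_pre_digraph \<Rightarrow> 'a set \<Rightarrow> ('b \<Rightarrow> 'a) \<Rightarrow> bool" where
  "induced_copy F H U \<psi> \<longleftrightarrow> bij_betw \<psi> (pverts H) U \<and>
     (\<forall>i\<in>pverts H. \<forall>j\<in>pverts H. (i, j) \<in> parcs H \<longleftrightarrow> (\<psi> i, \<psi> j) \<in> F)"

text \<open>
  The two target graphs have the projections as end maps, so the arc component of an isomorphism is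
  determined by its vertex component. The second part recovers a prescribed set of vertices, as needed
  for the centres of two copies of \<open>P\<^sub>3\<close>.
\<close>

lemma isomorphism_imp_induced_copy:
  assumes iso: "pre_digraph.digraph_isomorphism (with_proj G \<restriction> U) f"
    and H: "with_proj H = app_iso f (with_proj G \<restriction> U)"
  shows "induced_copy (parcs G) H U (the_inv_into U (iso_verts f))"
    and "S \<subseteq> U \<Longrightarrow> the_inv_into U (iso_verts f) ` iso_verts f ` S = S"
proof -
  let ?\<phi> = "iso_verts f" and ?\<psi> = "the_inv_into U (iso_verts f)"
  have inj: "inj_on ?\<phi> U" using iso by (simp add: pre_digraph.digraph_isomorphism_def)
  have vs: "pverts H = ?\<phi> ` U" using arg_cong[OF H, of verts] by simp
  have ends: "iso_tail f = fst" "iso_head f = snd"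
    using arg_cong[OF H, of tail] arg_cong[OF H, of head] by simp_all
  have as: "parcs H = iso_arcs f ` (parcs G \<inter> U \<times> U)"
    using arg_cong[OF H, of arcs] by (auto simp: image_def)
  have arc: "iso_arcs f (a, b) = (?\<phi> a, ?\<phi> b)" if "(a, b) \<in> parcs G" "a \<in> U" "b \<in> U" for a b
  proof -
    have "?\<phi> a = fst (iso_arcs f (a, b)) \<and> ?\<phi> b = snd (iso_arcs f (a, b))"
      using iso that by (auto simp: pre_digraph.digraph_isomorphism_def ends)
    then show ?thesis by (metis prod.collapse)
  qed
  have edge: "(?\<phi> a, ?\<phi> b) \<in> parcs H \<longleftrightarrow> (a, b) \<in> parcs G" if ab: "a \<in> U" "b \<in> U" for a b
  proof
    assume "(?\<phi> a, ?\<phi> b) \<in> parcs H"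
    then obtain a' b' where "(a', b') \<in> parcs G" "a' \<in> U" "b' \<in> U" "(?\<phi> a, ?\<phi> b) = iso_arcs f (a', b')"
      unfolding as by auto
    moreover from this have "a = a'" "b = b'"
      using arc inj ab by (auto dest: inj_onD)
    ultimately show "(a, b) \<in> parcs G" by simp
  next
    assume "(a, b) \<in> parcs G"
    then show "(?\<phi> a, ?\<phi> b) \<in> parcs H" unfolding as using ab arc by force
  qed
  have "bij_betw ?\<psi> (pverts H) U"
    unfolding vs by (rule bij_betw_the_inv_into) (simp add: bij_betw_def inj)
  moreover have "(i, j) \<in> parcs H \<longleftrightarrow> (?\<psi> i, ?\<psi> j) \<in> parcs G"
    if "i \<in> pverts H" "j \<in> pverts H" for i j
    using that inj edge by (auto simp: vs the_inv_into_f_f)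
  ultimately show "induced_copy (parcs G) H U ?\<psi>" by (simp add: induced_copy_def)
  show "?\<psi> ` ?\<phi> ` S = S" if "S \<subseteq> U"
    using that inj by (force simp: image_image the_inv_into_f_f subset_eq)
qed

lemma induced_copy_imp_isomorphism:
  assumes copy: "induced_copy (parcs G) H U \<psi>" and wf: "wf_digraph (with_proj G \<restriction> U)"
    and H: "parcs H \<subseteq> pverts H \<times> pverts H"
  obtains f where "pre_digraph.digraph_isomorphism (with_proj G \<restriction> U) f"
    and "with_proj H = app_iso f (with_proj G \<restriction> U)"
    and "\<And>i. i \<in> pverts H \<Longrightarrow> iso_verts f (\<psi> i) = i"
proof -
  define \<phi> where "\<phi> = the_inv_into (pverts H) \<psi>"
  define f where "f = \<lparr> iso_verts = \<phi>, iso_arcs = map_prod \<phi> \<phi>, iso_head = snd, iso_tail = fst \<rparr>"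
  have inj: "inj_on \<psi> (pverts H)" and U: "U = \<psi> ` pverts H"
    using copy by (auto simp: induced_copy_def bij_betw_def)
  have edge: "(i, j) \<in> parcs H \<longleftrightarrow> (\<psi> i, \<psi> j) \<in> parcs G" if "i \<in> pverts H" "j \<in> pverts H" for i j
    using copy that by (simp add: induced_copy_def)
  have \<phi>\<psi>: "\<phi> (\<psi> i) = i" if "i \<in> pverts H" for i
    using that inj by (simp add: \<phi>_def the_inv_into_f_f)
  have inj\<phi>: "inj_on \<phi> U" using \<phi>\<psi> by (auto simp: U inj_on_def)
  have "inj_on (map_prod \<phi> \<phi>) (U \<times> U)" using inj\<phi> by (intro map_prod_inj_on)
  then have "inj_on (map_prod \<phi> \<phi>) (arcs (with_proj G \<restriction> U))"
    by (rule inj_on_subset) auto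
  then have "pre_digraph.digraph_isomorphism (with_proj G \<restriction> U) f"
    using wf inj\<phi> by (auto simp: pre_digraph.digraph_isomorphism_def f_def)
  moreover have "with_proj H = app_iso f (with_proj G \<restriction> U)"
  proof (rule pre_digraph.equality)
    show "verts (with_proj H) = verts (app_iso f (with_proj G \<restriction> U))"
      using \<phi>\<psi> by (force simp: f_def U)
    show "arcs (with_proj H) = arcs (app_iso f (with_proj G \<restriction> U))"
    proof (intro subset_antisym subrelI)
      fix i j assume ij: "(i, j) \<in> arcs (with_proj H)"
      then have v: "i \<in> pverts H" "j \<in> pverts H" using H by auto
      then have "(\<psi> i, \<psi> j) \<in> arcs (with_proj G \<restriction> U)" using edge ij by (simp add: U)
      moreover have "map_prod \<phi> \<phi> (\<psi> i, \<psi> j) = (i, j)" using v \<phi>\<psi> by simp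
      ultimately show "(i, j) \<in> arcs (app_iso f (with_proj G \<restriction> U))"
        unfolding f_def app_iso_simps digraph_isomorphism.simps by (metis imageI)
    next
      fix i j assume "(i, j) \<in> arcs (app_iso f (with_proj G \<restriction> U))"
      then show "(i, j) \<in> arcs (with_proj H)" using edge \<phi>\<psi> by (auto simp: f_def U)
    qed
  qed (simp_all add: f_def)
  moreover have "iso_verts f (\<psi> i) = i" if "i \<in> pverts H" for i
    using \<phi>\<psi> that by (simp add: f_def)
  ultimately show thesis by (rule that)
qed

lemma digraph_iso_iff_induced_copy:
  assumes "wf_digraph (with_proj G \<restriction> U)" and "parcs H \<subseteq> pverts H \<times> pverts H"
  shows "digraph_iso (with_proj G \<restriction> U) (with_proj H) \<longleftrightarrow> (\<exists>\<psi>. induced_copy (parcs G) H U \<psi>)"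
proof
  assume "digraph_iso (with_proj G \<restriction> U) (with_proj H)"
  then obtain f where "pre_digraph.digraph_isomorphism (with_proj G \<restriction> U) f"
    "with_proj H = app_iso f (with_proj G \<restriction> U)"
    unfolding digraph_iso_def by auto
  from isomorphism_imp_induced_copy(1)[OF this]
  show "\<exists>\<psi>. induced_copy (parcs G) H U \<psi>" by blast
next
  assume "\<exists>\<psi>. induced_copy (parcs G) H U \<psi>"
  then obtain \<psi> where \<psi>: "induced_copy (parcs G) H U \<psi>" ..
  obtain f where "pre_digraph.digraph_isomorphism (with_proj G \<restriction> U) f"
    "with_proj H = app_iso f (with_proj G \<restriction> U)"
    using induced_copy_imp_isomorphism[OF \<psi> assms] .
  then show "digraph_iso (with_proj G \<restriction> U) (with_proj H)"
    unfolding digraph_iso_def by (intro exI[of _ f] conjI)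
qed

lemma path_graph_simps:
  "pverts (path_graph r) = {..<r}"
  "(i, j) \<in> parcs (path_graph r) \<longleftrightarrow> i < r \<and> j < r \<and> (j = Suc i \<or> i = Suc j)"
  by (auto simp: path_graph_def undirected_def)

lemma two_P3_simps:
  "pverts two_P3 = Inl ` {..<3} \<union> Inr ` {..<3}"
  "(Inl i, Inl j) \<in> parcs two_P3 \<longleftrightarrow> (i, j) \<in> parcs (path_graph 3)"
  "(Inr i, Inr j) \<in> parcs two_P3 \<longleftrightarrow> (i, j) \<in> parcs (path_graph 3)"
  "(Inl i, Inr j) \<notin> parcs two_P3" "(Inr i, Inl j) \<notin> parcs two_P3"
  by (auto simp: two_P3_def disjoint_union_def path_graph_simps(1) Plus_def)

lemma parcs_path_graph_subset: "parcs (path_graph r) \<subseteq> pverts (path_graph r) \<times> pverts (path_graph r)"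
  by (auto simp: path_graph_simps)

lemma parcs_two_P3_subset: "parcs two_P3 \<subseteq> pverts two_P3 \<times> pverts two_P3"
  by (auto simp: two_P3_def disjoint_union_def path_graph_simps)

lemma iso_two_P3_with_centres_iff:
  assumes wf: "wf_digraph (with_proj G \<restriction> U)" and S: "S \<subseteq> U"
  shows "iso_two_P3_with_centres (with_proj G \<restriction> U) S \<longleftrightarrow>
    (\<exists>\<psi>. induced_copy (parcs G) two_P3 U \<psi> \<and> S = {\<psi> (Inl 1), \<psi> (Inr 1)})"
proof
  assume "iso_two_P3_with_centres (with_proj G \<restriction> U) S"
  then obtain f where f: "pre_digraph.digraph_isomorphism (with_proj G \<restriction> U) f"
    "with_proj two_P3 = app_iso f (with_proj G \<restriction> U)" "iso_verts f ` S = {Inl 1, Inr 1}"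
    by (auto simp: iso_two_P3_with_centres_def)
  let ?\<psi> = "the_inv_into U (iso_verts f)"
  have "?\<psi> ` {Inl 1, Inr 1} = S"
    using isomorphism_imp_induced_copy(2)[OF f(1,2) S] unfolding f(3) .
  then show "\<exists>\<psi>. induced_copy (parcs G) two_P3 U \<psi> \<and> S = {\<psi> (Inl 1), \<psi> (Inr 1)}"
    using isomorphism_imp_induced_copy(1)[OF f(1,2)] by (intro exI[of _ ?\<psi>]) auto
next
  assume "\<exists>\<psi>. induced_copy (parcs G) two_P3 U \<psi> \<and> S = {\<psi> (Inl 1), \<psi> (Inr 1)}"
  then obtain \<psi> where \<psi>: "induced_copy (parcs G) two_P3 U \<psi>" "S = {\<psi> (Inl 1), \<psi> (Inr 1)}" by blast
  obtain f where f: "pre_digraph.digraph_isomorphism (with_proj G \<restriction> U) f"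
    "with_proj two_P3 = app_iso f (with_proj G \<restriction> U)"
    "\<And>i. i \<in> pverts two_P3 \<Longrightarrow> iso_verts f (\<psi> i) = i"
    by (rule induced_copy_imp_isomorphism[OF \<psi>(1) wf parcs_two_P3_subset], rule that) blast+
  have "iso_verts f ` S = {Inl 1, Inr 1}"
    using f(3)[of "Inl 1"] f(3)[of "Inr 1"] \<psi>(2) by (simp add: two_P3_simps)
  then show "iso_two_P3_with_centres (with_proj G \<restriction> U) S"
    unfolding iso_two_P3_with_centres_def using f(1,2) by (intro exI[of _ f] conjI)
qed

lemma induced_copy_path_nth:
  assumes "distinct vs"
    and "\<forall>i<length vs. \<forall>j<length vs. (vs ! i, vs ! j) \<in> F \<longleftrightarrow> j = Suc i \<or> i = Suc j"
  shows "induced_copy F (path_graph (length vs)) (set vs) (nth vs)"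
  using assms by (auto simp: induced_copy_def path_graph_simps intro!: bij_betw_nth)

lemma induced_copy_two_P3:
  assumes dist: "distinct [p, a, p', q, b, q']" and sym: "sym F"
    and Na: "F `` {a} = {p, p'}" and Nb: "F `` {b} = {q, q'}"
    and indep: "\<forall>v\<in>{p, p', q, q'}. \<forall>w\<in>{p, p', q, q'}. (v, w) \<notin> F"
  shows "induced_copy F two_P3 ({a, b} \<union> F `` {a} \<union> F `` {b}) (case_sum (nth [p, a, p']) (nth [q, b, q']))"
proof -
  have a: "(a, v) \<in> F \<longleftrightarrow> v = p \<or> v = p'" "(v, a) \<in> F \<longleftrightarrow> v = p \<or> v = p'" for v
    using Na sym by (auto dest: symD)
  have b: "(b, v) \<in> F \<longleftrightarrow> v = q \<or> v = q'" "(v, b) \<in> F \<longleftrightarrow> v = q \<or> v = q'" for v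
    using Nb sym by (auto dest: symD)
  have three: "{..<3::nat} = {0, 1, 2}" by auto
  show ?thesis
    unfolding induced_copy_def two_P3_simps(1) three Na Nb
  proof (intro conjI)
    show "bij_betw (case_sum (nth [p, a, p']) (nth [q, b, q']))
      (Inl ` {0, 1, 2} \<union> Inr ` {0, 1, 2}) ({a, b} \<union> {p, p'} \<union> {q, q'})"
      using dist by (auto simp: bij_betw_def inj_on_def)
    show "\<forall>i\<in>Inl ` {0, 1, 2} \<union> Inr ` {0, 1, 2}. \<forall>j\<in>Inl ` {0, 1, 2} \<union> Inr ` {0, 1, 2}.
      (i, j) \<in> parcs two_P3 \<longleftrightarrow>
      (case_sum (nth [p, a, p']) (nth [q, b, q']) i, case_sum (nth [p, a, p']) (nth [q, b, q']) j) \<in> F"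
      using dist dist[THEN distinct_rev[THEN iffD2]] indep
      by (simp add: two_P3_simps path_graph_simps a b)
  qed
qed

section \<open>Two stars as induced paths\<close>

context long_even_cycles
begin

lemma N_eqI:
  assumes "a \<in> X \<union> Y" "p \<noteq> q" "(a, p) \<in> F" "(a, q) \<in> F"
  shows "N a = {p, q}"
proof -
  have "{p, q} \<subseteq> N a" using assms by auto
  then have "{p, q} = N a"
    using assms F_deg[of a] finite_N[of a] by (intro card_subset_eq) auto
  then show ?thesis ..
qed

lemma F_between: "(a, b) \<in> F \<Longrightarrow> a \<in> X \<and> b \<in> Y \<or> a \<in> Y \<and> b \<in> X"
  using F_sub by blast

text \<open>
  The inner vertices \<open>1\<close> and \<open>3\<close> of the path have both their neighbours on it, and together with these
  they cover it. The same holds for \<open>1\<close> and \<open>4\<close> on six vertices, and for the two centres of \<open>2P\<^sub>3\<close>.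
\<close>

lemma path5_imp_two_stars:
  assumes copy: "induced_copy F (path_graph 5) U \<psi>" and U: "U \<subseteq> X \<union> Y"
  shows "two_stars (\<psi> 1) (\<psi> 3) U"
proof -
  have v: "{..<5::nat} = {0, 1, 2, 3, 4}" by auto
  have inj: "inj_on \<psi> {..<5}" and im: "U = \<psi> ` {..<5}"
    and edge: "\<And>i j. i < 5 \<Longrightarrow> j < 5 \<Longrightarrow> (\<psi> i, \<psi> j) \<in> F \<longleftrightarrow> j = Suc i \<or> i = Suc j"
    using copy by (auto simp: induced_copy_def path_graph_simps bij_betw_def)
  have UU: "U = {\<psi> 0, \<psi> 1, \<psi> 2, \<psi> 3, \<psi> 4}" unfolding im v by simp
  have ne: "\<psi> i \<noteq> \<psi> j" if "i < 5" "j < 5" "i \<noteq> j" for i j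
    using inj that by (auto dest: inj_onD)
  have "N (\<psi> 1) = {\<psi> 0, \<psi> 2}"
    using ne[of 0 2] edge[of 1 0] edge[of 1 2] U UU by (intro N_eqI) auto
  moreover have "N (\<psi> 3) = {\<psi> 2, \<psi> 4}"
    using ne[of 2 4] edge[of 3 2] edge[of 3 4] U UU by (intro N_eqI) auto
  ultimately show ?thesis
    unfolding two_stars_def using U UU ne[of 1 3] edge[of 1 3] by auto
qed

lemma path6_imp_two_stars:
  assumes copy: "induced_copy F (path_graph 6) U \<psi>" and U: "U \<subseteq> X \<union> Y"
  shows "two_stars (\<psi> 1) (\<psi> 4) U"
proof -
  have v: "{..<6::nat} = {0, 1, 2, 3, 4, 5}" by auto
  have inj: "inj_on \<psi> {..<6}" and im: "U = \<psi> ` {..<6}"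
    and edge: "\<And>i j. i < 6 \<Longrightarrow> j < 6 \<Longrightarrow> (\<psi> i, \<psi> j) \<in> F \<longleftrightarrow> j = Suc i \<or> i = Suc j"
    using copy by (auto simp: induced_copy_def path_graph_simps bij_betw_def)
  have UU: "U = {\<psi> 0, \<psi> 1, \<psi> 2, \<psi> 3, \<psi> 4, \<psi> 5}" unfolding im v by simp
  have ne: "\<psi> i \<noteq> \<psi> j" if "i < 6" "j < 6" "i \<noteq> j" for i j
    using inj that by (auto dest: inj_onD)
  have "N (\<psi> 1) = {\<psi> 0, \<psi> 2}"
    using ne[of 0 2] edge[of 1 0] edge[of 1 2] U UU by (intro N_eqI) auto
  moreover have "N (\<psi> 4) = {\<psi> 3, \<psi> 5}"
    using ne[of 3 5] edge[of 4 3] edge[of 4 5] U UU by (intro N_eqI) auto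
  ultimately show ?thesis
    unfolding two_stars_def using U UU ne[of 1 4] edge[of 1 4] by auto
qed

lemma two_P3_imp_two_stars:
  assumes copy: "induced_copy F two_P3 U \<psi>" and U: "U \<subseteq> X \<union> Y"
  shows "two_stars (\<psi> (Inl 1)) (\<psi> (Inr 1)) U"
proof -
  have v: "pverts two_P3 = {Inl 0, Inl 1, Inl 2, Inr 0, Inr 1, Inr 2}"
    by (auto simp: two_P3_simps)
  have inj: "inj_on \<psi> (pverts two_P3)" and im: "U = \<psi> ` pverts two_P3"
    and edge: "\<And>i j. i \<in> pverts two_P3 \<Longrightarrow> j \<in> pverts two_P3 \<Longrightarrow>
      (\<psi> i, \<psi> j) \<in> F \<longleftrightarrow> (i, j) \<in> parcs two_P3"
    using copy by (auto simp: induced_copy_def bij_betw_def)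
  have UU: "U = {\<psi> (Inl 0), \<psi> (Inl 1), \<psi> (Inl 2), \<psi> (Inr 0), \<psi> (Inr 1), \<psi> (Inr 2)}"
    unfolding im v by simp
  have ne: "\<psi> i \<noteq> \<psi> j" if "i \<in> pverts two_P3" "j \<in> pverts two_P3" "i \<noteq> j" for i j
    using inj that by (auto dest: inj_onD)
  have "N (\<psi> (Inl 1)) = {\<psi> (Inl 0), \<psi> (Inl 2)}"
    using ne[of "Inl 0" "Inl 2"] edge[of "Inl 1" "Inl 0"] edge[of "Inl 1" "Inl 2"] U UU
    by (intro N_eqI) (auto simp: v two_P3_simps(2-) path_graph_simps)
  moreover have "N (\<psi> (Inr 1)) = {\<psi> (Inr 0), \<psi> (Inr 2)}"
    using ne[of "Inr 0" "Inr 2"] edge[of "Inr 1" "Inr 0"] edge[of "Inr 1" "Inr 2"] U UU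
    by (intro N_eqI) (auto simp: v two_P3_simps(2-) path_graph_simps)
  moreover have "\<psi> (Inl 1) \<noteq> \<psi> (Inr 1)" "(\<psi> (Inl 1), \<psi> (Inr 1)) \<notin> F"
    using ne[of "Inl 1" "Inr 1"] edge[of "Inl 1" "Inr 1"] by (auto simp: v two_P3_simps(2-))
  ultimately show ?thesis
    unfolding two_stars_def using U UU by auto
qed

lemma N_pair_containing:
  assumes "a \<in> X \<union> Y" "x \<in> N a"
  obtains p where "p \<noteq> x" "N a = {p, x}"
  using N_pair[OF assms(1)] assms(2) by (metis insert_commute insertE singletonD)

text \<open>
  Stars with centres on the same side are joined only by a shared leaf, and they share at most one since
  there is no 4-cycle. With a shared leaf \<open>x\<close> the path is \<open>p a x b q\<close>.
\<close>

lemma two_stars_same_side: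
  assumes ab: "a \<in> Y" "b \<in> Y" and U: "two_stars a b U"
  shows "card (U \<inter> X) = 3 \<and> card (U \<inter> Y) = 2 \<and> (\<exists>\<psi>. induced_copy F (path_graph 5) U \<psi>) \<or>
    card (U \<inter> X) = 4 \<and> card (U \<inter> Y) = 2 \<and>
      (\<exists>\<psi>. induced_copy F two_P3 U \<psi> \<and> U \<inter> Y = {\<psi> (Inl 1), \<psi> (Inr 1)})"
proof -
  have Na: "N a \<subseteq> X" and Nb: "N b \<subseteq> X" using ab N_Y by auto
  have nab: "a \<noteq> b" and U: "U = {a, b} \<union> N a \<union> N b" using U by (auto simp: two_stars_def)
  have UX: "U \<inter> X = N a \<union> N b" and UY: "U \<inter> Y = {a, b}" using U Na Nb ab disj by auto
  have FX: "(v, w) \<notin> F" if "v \<in> X" "w \<in> X" for v w using F_between[of v w] that disj by auto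
  show ?thesis
  proof (cases "N a \<inter> N b = {}")
    case True
    obtain p p' where p: "p \<noteq> p'" "N a = {p, p'}" using N_pair[of a] ab by blast
    obtain q q' where q: "q \<noteq> q'" "N b = {q, q'}" using N_pair[of b] ab by blast
    have dist: "distinct [p, a, p', q, b, q']"
      using p q True nab Na Nb ab disj by auto
    have "induced_copy F two_P3 U (case_sum (nth [p, a, p']) (nth [q, b, q']))"
      unfolding U using p q dist Na Nb by (intro induced_copy_two_P3 F_sym) (auto simp: FX)
    moreover have "card (N a \<union> N b) = 4"
      using True F_deg[of a] F_deg[of b] ab finite_N by (simp add: card_Un_disjoint)
    ultimately show ?thesis
      unfolding UX UY using nab by (intro disjI2 conjI exI[of _ "case_sum (nth [p, a, p']) (nth [q, b, q'])"]) auto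
  next
    case False
    then obtain x where x: "x \<in> N a" "x \<in> N b" by blast
    obtain p where p: "p \<noteq> x" "N a = {p, x}" using N_pair_containing[of a x] ab x by blast
    obtain q where q: "q \<noteq> x" "N b = {q, x}" using N_pair_containing[of b x] ab x by blast
    have Nx: "N x = {a, b}" using x Na nab F_symD by (intro N_eqI) auto
    have pq: "p \<noteq> q" using no_C4[of a b p x] p q nab F_symD by blast
    have dist: "distinct [p, a, x, b, q]" using p q pq nab Na Nb ab disj by auto
    have a: "(a, v) \<in> F \<longleftrightarrow> v = p \<or> v = x" "(v, a) \<in> F \<longleftrightarrow> v = p \<or> v = x" for v
      using p F_symD by auto
    have b: "(b, v) \<in> F \<longleftrightarrow> v = q \<or> v = x" "(v, b) \<in> F \<longleftrightarrow> v = q \<or> v = x" for v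
      using q F_symD by auto
    have X: "p \<in> X" "x \<in> X" "q \<in> X" using p q Na Nb by auto
    have "induced_copy F (path_graph (length [p, a, x, b, q])) (set [p, a, x, b, q]) (nth [p, a, x, b, q])"
      using dist dist[THEN distinct_rev[THEN iffD2]] X
      by (intro induced_copy_path_nth) (simp_all add: All_less_Suc a b FX)
    moreover have "set [p, a, x, b, q] = U" using U p q by auto
    moreover have "length [p, a, x, b, q] = 5" by simp
    ultimately have "induced_copy F (path_graph 5) U (nth [p, a, x, b, q])" by (simp only:)
    moreover have "card (U \<inter> X) = 3"
    proof -
      have "N a \<union> N b = {p, x, q}" using p q by auto
      then show ?thesis unfolding UX using p q pq by simp
    qed
    moreover have "card (U \<inter> Y) = 2" unfolding UY using nab by simp
    ultimately show ?thesis by blast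
  qed
qed

text \<open>
  Stars with centres on opposite sides are disjoint. If an edge joins a leaf \<open>p\<close> of the first to a leaf
  \<open>q\<close> of the second, the path is \<open>p' a p q b q'\<close>: the degrees of \<open>p\<close> and \<open>q\<close> are exhausted, and an edge
  between the ends \<open>p'\<close> and \<open>q'\<close> would close a 6-cycle.
\<close>

lemma two_stars_opposite:
  assumes ab: "a \<in> X" "b \<in> Y" and U: "two_stars a b U"
  shows "card (U \<inter> X) = 3 \<and> card (U \<inter> Y) = 3 \<and>
    ((\<exists>\<psi>. induced_copy F (path_graph 6) U \<psi>) \<or> (\<exists>\<psi>. induced_copy F two_P3 U \<psi>))"
proof -
  have Na: "N a \<subseteq> Y" and Nb: "N b \<subseteq> X" using ab N_X N_Y by auto
  have nF: "(a, b) \<notin> F" "(b, a) \<notin> F" and nab: "a \<noteq> b" and U: "U = {a, b} \<union> N a \<union> N b"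
    using U F_symD by (auto simp: two_stars_def)
  have UX: "U \<inter> X = insert a (N b)" and UY: "U \<inter> Y = insert b (N a)"
    using U Na Nb ab disj by auto
  have cards: "card (U \<inter> X) = 3" "card (U \<inter> Y) = 3"
    unfolding UX UY using nF F_deg[of a] F_deg[of b] ab finite_N by simp_all
  have FX: "(v, w) \<notin> F" if "v \<in> X" "w \<in> X" for v w using F_between[of v w] that disj by auto
  have FY: "(v, w) \<notin> F" if "v \<in> Y" "w \<in> Y" for v w using F_between[of v w] that disj by auto
  show ?thesis
  proof (cases "\<exists>p\<in>N a. \<exists>q\<in>N b. (p, q) \<in> F")
    case True
    then obtain p q where pq: "p \<in> N a" "q \<in> N b" "(p, q) \<in> F" by blast
    obtain p' where p: "p' \<noteq> p" "N a = {p', p}" using N_pair_containing[of a p] ab pq by blast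
    obtain q' where q: "q' \<noteq> q" "N b = {q', q}" using N_pair_containing[of b q] ab pq by blast
    have X: "a \<in> X" "q \<in> X" "q' \<in> X" and Y: "b \<in> Y" "p \<in> Y" "p' \<in> Y"
      using p q Na Nb ab by auto
    have aq: "a \<noteq> q" "a \<noteq> q'" "b \<noteq> p" "b \<noteq> p'" using p q nF by auto
    have dist: "distinct [p', a, p, q, b, q']" using p q aq X Y disj by auto
    have Np: "N p = {a, q}" using Y aq pq F_symD by (intro N_eqI) auto
    have Nq: "N q = {b, p}" using X aq pq F_symD by (intro N_eqI) auto
    have a: "(a, v) \<in> F \<longleftrightarrow> v = p' \<or> v = p" "(v, a) \<in> F \<longleftrightarrow> v = p' \<or> v = p" for v
      using p F_symD by auto
    have b: "(b, v) \<in> F \<longleftrightarrow> v = q' \<or> v = q" "(v, b) \<in> F \<longleftrightarrow> v = q' \<or> v = q" for v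
      using q F_symD by auto
    have pp: "(p, v) \<in> F \<longleftrightarrow> v = a \<or> v = q" "(v, p) \<in> F \<longleftrightarrow> v = a \<or> v = q" for v
      using Np F_symD by auto
    have qq: "(q, v) \<in> F \<longleftrightarrow> v = b \<or> v = p" "(v, q) \<in> F \<longleftrightarrow> v = b \<or> v = p" for v
      using Nq F_symD by auto
    have end1: "(p', q') \<notin> F"
    proof
      assume "(p', q') \<in> F"
      then show False
        using no_C6[of a q q' p b p'] p q aq X pq F_symD by blast
    qed
    then have ends: "(p', q') \<notin> F" "(q', p') \<notin> F" using F_symD by blast+
    have "induced_copy F (path_graph (length [p', a, p, q, b, q'])) (set [p', a, p, q, b, q'])
        (nth [p', a, p, q, b, q'])"
      using dist dist[THEN distinct_rev[THEN iffD2]] X Y nF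
      by (intro induced_copy_path_nth) (simp_all add: All_less_Suc a b pp qq ends FX FY)
    moreover have "set [p', a, p, q, b, q'] = U" using U p q by auto
    moreover have "length [p', a, p, q, b, q'] = 6" by simp
    ultimately have "induced_copy F (path_graph 6) U (nth [p', a, p, q, b, q'])" by (simp only:)
    then show ?thesis using cards by blast
  next
    case False
    obtain p p' where p: "p \<noteq> p'" "N a = {p, p'}" using N_pair[of a] ab by blast
    obtain q q' where q: "q \<noteq> q'" "N b = {q, q'}" using N_pair[of b] ab by blast
    have no: "(v, w) \<notin> F" "(w, v) \<notin> F" if "v \<in> N a" "w \<in> N b" for v w
      using False that F_symD by blast+
    have dist: "distinct [p, a, p', q, b, q']"
      using p q nab nF Na Nb ab disj by auto
    have "(v, w) \<notin> F" if "v \<in> N a \<union> N b" "w \<in> N a \<union> N b" for v w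
      using that no FX[of v w] FY[of v w] Na Nb by blast
    then have "\<forall>v\<in>{p, p', q, q'}. \<forall>w\<in>{p, p', q, q'}. (v, w) \<notin> F" unfolding p q by auto
    then have "induced_copy F two_P3 U (case_sum (nth [p, a, p']) (nth [q, b, q']))"
      unfolding U using p q dist by (intro induced_copy_two_P3 F_sym) auto
    then show ?thesis using cards by blast
  qed
qed

lemma two_stars_commute: "two_stars a b U \<longleftrightarrow> two_stars b a U"
  unfolding two_stars_def using F_symD by blast

text \<open>
  From left to right the sides of the two centres decide which case occurs and which sizes it has. From
  right to left two vertices of the path, or the centres of \<open>2P\<^sub>3\<close>, are the centres of the stars.
\<close>

lemma two_stars_iff_induced_copy:
  assumes U: "U \<subseteq> X \<union> Y"
  shows "(\<exists>a b. two_stars a b U) \<longleftrightarrow>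
    (card (U \<inter> X), card (U \<inter> Y)) \<in> {(3, 2), (2, 3)} \<and> (\<exists>\<psi>. induced_copy F (path_graph 5) U \<psi>) \<or>
    ((card (U \<inter> X), card (U \<inter> Y)) = (4, 2) \<and>
       (\<exists>\<psi>. induced_copy F two_P3 U \<psi> \<and> U \<inter> Y = {\<psi> (Inl 1), \<psi> (Inr 1)}) \<or>
     (card (U \<inter> X), card (U \<inter> Y)) = (2, 4) \<and>
       (\<exists>\<psi>. induced_copy F two_P3 U \<psi> \<and> U \<inter> X = {\<psi> (Inl 1), \<psi> (Inr 1)})) \<or>
    card (U \<inter> X) = 3 \<and> card (U \<inter> Y) = 3 \<and>
      ((\<exists>\<psi>. induced_copy F (path_graph 6) U \<psi>) \<or> (\<exists>\<psi>. induced_copy F two_P3 U \<psi>))"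
    (is "?L \<longleftrightarrow> ?R")
proof
  interpret sw: long_even_cycles Y X F by (rule swap)
  assume ?L
  then obtain a b where ab: "two_stars a b U" by blast
  then consider "a \<in> X" "b \<in> X" | "a \<in> Y" "b \<in> Y" | "a \<in> X" "b \<in> Y" | "a \<in> Y" "b \<in> X"
    by (auto simp: two_stars_def)
  then show ?R
  proof cases
    case 1
    then show ?thesis using sw.two_stars_same_side[of a b U] ab unfolding two_stars_swap by auto
  next
    case 2
    then show ?thesis using two_stars_same_side[of a b U] ab by auto
  next
    case 3
    then show ?thesis using two_stars_opposite[of a b U] ab by auto
  next
    case 4
    then show ?thesis using two_stars_opposite[of b a U] ab two_stars_commute[of a b U] by auto
  qed
next
  assume ?R
  then show ?L
    using path5_imp_two_stars[OF _ U] path6_imp_two_stars[OF _ U] two_P3_imp_two_stars[OF _ U]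
    by blast
qed

end

section \<open>The cycle on the residues modulo n\<close>

lemma pred_mod: "i \<in> Zn n \<Longrightarrow> (i - 1) mod int n = (if i = 0 then int n - 1 else i - 1)"
  by (auto simp: Zn_def zmod_minus1)

lemma succ_mod: "i \<in> Zn n \<Longrightarrow> (i + 1) mod int n = (if i = int n - 1 then 0 else i + 1)"
  by (auto simp: Zn_def)

lemma Fn_Image_ux:
  assumes "i \<in> Zn n"
  shows "parcs (Fn n) `` {ux i} = {vy i, vy ((i - 1) mod int n)}"
  using assms by (auto simp: Fn_def undirected_def)

lemma Fn_Image_vy:
  assumes j: "j \<in> Zn n"
  shows "parcs (Fn n) `` {vy j} = {ux j, ux ((j + 1) mod int n)}"
proof -
  have "j = (i - 1) mod int n \<longleftrightarrow> i = (j + 1) mod int n" if "i \<in> Zn n" for i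
    using j that by (simp only: pred_mod succ_mod) (auto simp: Zn_def)
  moreover have "(j + 1) mod int n \<in> Zn n" using j by (auto simp: Zn_def)
  ultimately show ?thesis using j by (auto simp: Fn_def undirected_def)
qed

lemma Fn_subset: "parcs (Fn n) \<subseteq> Xn n \<times> Yn n \<union> Yn n \<times> Xn n"
  by (auto simp: Fn_def undirected_def Xn_def Yn_def Zn_def)

lemma Fn_ux_iff:
  assumes "i \<in> Zn n"
  shows "(ux i, b) \<in> parcs (Fn n) \<longleftrightarrow> b = vy i \<or> b = vy (if i = 0 then int n - 1 else i - 1)"
  using Fn_Image_ux[OF assms] unfolding pred_mod[OF assms] by blast

lemma sym_Fn: "sym (parcs (Fn n))"
  by (auto simp: Fn_def undirected_def sym_def)

text \<open>
  The vertex \<open>u\<^sub>i\<close> has the neighbours \<open>v\<^sub>i\<close> and \<open>v\<close> with the preceding index, so two common neighbours of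
  \<open>u\<^sub>i\<close> and \<open>u\<^sub>j\<close> make each of \<open>i\<close> and \<open>j\<close> the predecessor of the other. With \<open>pred\<close> written as a case
  distinction instead of a remainder this is linear arithmetic.
\<close>

lemma no_C4_indices:
  fixes i j k l m :: int
  defines "pred \<equiv> \<lambda>i. if i = 0 then m - 1 else i - 1"
  assumes "m \<ge> 3" and "i \<in> {0..<m}" "j \<in> {0..<m}"
    and "k = i \<or> k = pred i" "k = j \<or> k = pred j" "l = i \<or> l = pred i" "l = j \<or> l = pred j"
  shows "i = j \<or> k = l"
  using assms by (auto simp: pred_def split: if_splits)

text \<open>
  Around a 6-cycle the index of its \<open>u\<close> vertices changes three times by \<open>1\<close> or \<open>-1\<close>. The total is
  odd and of absolute value at most \<open>3\<close>, hence not a multiple of \<open>m\<close>.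
\<close>

lemma no_C6_indices:
  fixes i j k m :: int
  defines "pred \<equiv> \<lambda>i. if i = 0 then m - 1 else i - 1"
  assumes "m \<ge> 4" and "i \<in> {0..<m}" "j \<in> {0..<m}" "k \<in> {0..<m}"
    and "j = pred i \<or> i = pred j" "k = pred j \<or> j = pred k" "i = pred k \<or> k = pred i"
  shows False
  using assms by (auto simp: pred_def split: if_splits)

lemma Fn_no_C4_ux:
  assumes n: "n \<ge> 3" and ij: "i \<in> Zn n" "j \<in> Zn n" and ne: "i \<noteq> j" "p \<noteq> q"
    and F: "(ux i, p) \<in> parcs (Fn n)" "(ux j, p) \<in> parcs (Fn n)"
      "(ux i, q) \<in> parcs (Fn n)" "(ux j, q) \<in> parcs (Fn n)"
  shows False
proof -
  define pred where "pred = (\<lambda>i. if i = 0 then int n - 1 else i - 1)"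
  obtain k where k: "p = vy k" "k = i \<or> k = pred i"
    using F(1) ij by (auto simp: Fn_ux_iff pred_def)
  obtain l where l: "q = vy l" "l = i \<or> l = pred i"
    using F(3) ij by (auto simp: Fn_ux_iff pred_def)
  have "k = j \<or> k = pred j" "l = j \<or> l = pred j"
    using F(2,4) ij k(1) l(1) by (auto simp: Fn_ux_iff pred_def)
  then show False
    using no_C4_indices[of "int n" i j k l] k l ij n ne by (auto simp: Zn_def pred_def)
qed

lemma Fn_common_neighbour:
  assumes "i \<in> Zn n" "j \<in> Zn n" "i \<noteq> j" "(ux i, p) \<in> parcs (Fn n)" "(p, ux j) \<in> parcs (Fn n)"
  shows "j = (if i = 0 then int n - 1 else i - 1) \<or> i = (if j = 0 then int n - 1 else j - 1)"
proof -
  have "(ux j, p) \<in> parcs (Fn n)" using assms(5) sym_Fn by (auto dest: symD)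
  then show ?thesis using assms unfolding Fn_ux_iff[OF assms(1)] Fn_ux_iff[OF assms(2)]
    by (auto simp: Zn_def split: if_splits)
qed

lemma card_Zn: "card (Zn n) = n" by (simp add: Zn_def)

lemma card_Xn: "card (Xn n) = n" and card_Yn: "card (Yn n) = n"
  by (simp_all add: Xn_def Yn_def card_Zn card_image inj_on_def)

lemma long_even_cycles_Fn:
  assumes n: "n \<ge> 5"
  shows "long_even_cycles (Xn n) (Yn n) (parcs (Fn n))"
proof
  note sym = symD[OF sym_Fn]
  have Zn_bounds: "i \<in> Zn n \<longleftrightarrow> 0 \<le> i \<and> i < int n" for i by (simp add: Zn_def)
  show "Xn n \<inter> Yn n = {}" by (auto simp: Xn_def Yn_def)
  show "finite (Xn n)" "finite (Yn n)" by (simp_all add: Xn_def Yn_def Zn_def)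
  show "5 \<le> card (Xn n)" "5 \<le> card (Yn n)" using n by (simp_all add: card_Xn card_Yn)
  show "parcs (Fn n) \<subseteq> Xn n \<times> Yn n \<union> Yn n \<times> Xn n" by (rule Fn_subset)
  show "sym (parcs (Fn n))" by (rule sym_Fn)
  show "card (parcs (Fn n) `` {a}) = 2" if "a \<in> Xn n \<union> Yn n" for a
  proof -
    consider i where "i \<in> Zn n" "a = ux i" | j where "j \<in> Zn n" "a = vy j"
      using \<open>a \<in> Xn n \<union> Yn n\<close> by (auto simp: Xn_def Yn_def)
    then show ?thesis
    proof cases
      case 1
      then have "i \<noteq> (i - 1) mod int n" using n by (simp add: pred_mod)
      then show ?thesis using 1 by (simp add: Fn_Image_ux)
    next
      case 2
      then have "j \<noteq> (j + 1) mod int n" using n by (simp add: succ_mod)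
      then show ?thesis using 2 by (simp add: Fn_Image_vy)
    qed
  qed
  show False
    if ne: "a \<noteq> b" "p \<noteq> q"
      and F: "(a, p) \<in> parcs (Fn n)" "(p, b) \<in> parcs (Fn n)" "(b, q) \<in> parcs (Fn n)" "(q, a) \<in> parcs (Fn n)"
    for a b p q
  proof -
    have n3: "n \<ge> 3" using n by simp
    consider "a \<in> Xn n" "b \<in> Xn n" | "p \<in> Xn n" "q \<in> Xn n"
      using F Fn_subset by (auto simp: Xn_def Yn_def)
    then show False
    proof cases
      case 1
      then obtain i j where ij: "i \<in> Zn n" "j \<in> Zn n" "a = ux i" "b = ux j"
        by (auto simp: Xn_def)
      show False
        using Fn_no_C4_ux[OF n3 ij(1,2)] ne F ij(3,4) sym by blast
    next
      case 2
      then obtain i j where ij: "i \<in> Zn n" "j \<in> Zn n" "p = ux i" "q = ux j"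
        by (auto simp: Xn_def)
      show False
        using Fn_no_C4_ux[OF n3 ij(1,2)] ne F ij(3,4) sym by blast
    qed
  qed
  show False
    if ne: "a \<noteq> b" "b \<noteq> c" "c \<noteq> a" and X: "a \<in> Xn n" "b \<in> Xn n" "c \<in> Xn n"
      and F: "(a, p) \<in> parcs (Fn n)" "(p, b) \<in> parcs (Fn n)" "(b, q) \<in> parcs (Fn n)"
        "(q, c) \<in> parcs (Fn n)" "(c, r) \<in> parcs (Fn n)" "(r, a) \<in> parcs (Fn n)"
    for a b c p q r
  proof -
    obtain i j k where ijk: "i \<in> Zn n" "j \<in> Zn n" "k \<in> Zn n" "a = ux i" "b = ux j" "c = ux k"
      using X by (auto simp: Xn_def)
    have "i \<noteq> j" "j \<noteq> k" "k \<noteq> i" using ne ijk by auto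
    then show False
      using no_C6_indices[of "int n" i j k] n
        Fn_common_neighbour[of i n j p] Fn_common_neighbour[of j n k q] Fn_common_neighbour[of k n i r]
        F ijk by (simp add: Zn_bounds)
  qed
qed

lemma bipartite_complement_Fn:
  assumes "n \<ge> 5"
  shows "long_even_cycles.E (Xn n) (Yn n) (parcs (Fn n)) = parcs (Gn n)"
  unfolding long_even_cycles.E_def[OF long_even_cycles_Fn[OF assms]] by (simp add: Gn_def)

text \<open>
  Consecutive pairs can be indexed by either member. The neighbourhood of \<open>u\<^sub>j\<close> is indexed by its last
  member, whereas the classification uses the first.
\<close>

lemma Zn_shift:
  assumes "n > 0"
  shows "(\<exists>i\<in>Zn n. P i ((i + 1) mod int n)) \<longleftrightarrow> (\<exists>j\<in>Zn n. P ((j - 1) mod int n) j)"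
proof
  assume "\<exists>i\<in>Zn n. P i ((i + 1) mod int n)"
  then obtain i where i: "i \<in> Zn n" "P i ((i + 1) mod int n)" by blast
  then have "((i + 1) mod int n - 1) mod int n = i" by (simp add: mod_diff_left_eq Zn_def)
  moreover have "(i + 1) mod int n \<in> Zn n" using assms by (simp add: Zn_def)
  ultimately show "\<exists>j\<in>Zn n. P ((j - 1) mod int n) j" using i by (intro bexI[of _ "(i + 1) mod int n"]) simp_all
next
  assume "\<exists>j\<in>Zn n. P ((j - 1) mod int n) j"
  then obtain j where j: "j \<in> Zn n" "P ((j - 1) mod int n) j" by blast
  then have "((j - 1) mod int n + 1) mod int n = j" by (simp add: mod_add_left_eq Zn_def)
  moreover have "(j - 1) mod int n \<in> Zn n" using assms by (simp add: Zn_def)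
  ultimately show "\<exists>i\<in>Zn n. P i ((i + 1) mod int n)" using j by (intro bexI[of _ "(j - 1) mod int n"]) simp_all
qed

section \<open>The classification\<close>

theorem theorem4p3:
  fixes n :: nat and T U UX UY :: "vertex set" and conds :: "bool list"
  assumes n: "n \<ge> 5"
    and T: "T \<subseteq> pverts (Gn n)"
    and U: "U = pverts (Gn n) - T" and UX: "UX = U \<inter> Xn n" and UY: "UY = U \<inter> Yn n"
    and conds: "conds =
      [T = {},
       U = Xn n \<or> U = Yn n,
       \<exists>i\<in>Zn n. U = Xn n \<union> {vy i} \<or> U = Yn n \<union> {ux i},
       \<exists>i\<in>Zn n. U = Xn n \<union> {vy i, vy ((i + 1) mod int n)} \<or>
                 U = Yn n \<union> {ux i, ux ((i + 1) mod int n)},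
       (card UX, card UY) \<in> {(3, 2), (2, 3)} \<and>
         digraph_iso (with_proj (Fn n) \<restriction> U) (with_proj (path_graph 5)),
       (card UX, card UY) = (4, 2) \<and> iso_two_P3_with_centres (with_proj (Fn n) \<restriction> U) UY \<or>
         (card UX, card UY) = (2, 4) \<and> iso_two_P3_with_centres (with_proj (Fn n) \<restriction> U) UX,
       card UX = 3 \<and> card UY = 3 \<and>
         (digraph_iso (with_proj (Fn n) \<restriction> U) (with_proj (path_graph 6)) \<or>
          digraph_iso (with_proj (Fn n) \<restriction> U) (with_proj two_P3))]"
  shows "(T \<in> cut_sets (with_proj (Gn n)) \<longleftrightarrow> (\<exists>k<7. conds ! k)) \<and>
         (\<forall>j<7. \<forall>k<7. j \<noteq> k \<longrightarrow> \<not> (conds ! j \<and> conds ! k))"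
proof
  interpret C: long_even_cycles "Xn n" "Yn n" "parcs (Fn n)" using n by (rule long_even_cycles_Fn)
  have V: "pverts (Gn n) = Xn n \<union> Yn n" by (simp add: Gn_def)
  have UV: "U \<subseteq> Xn n \<union> Yn n" using U V by blast
  have TU: "T = Xn n \<union> Yn n - U" using T U V by blast
  have wf: "wf_digraph (with_proj (Fn n) \<restriction> U)"
  proof -
    interpret pair_graph "Fn n" by (rule pair_graph_Fn)
    show ?thesis by (rule wellformed_induce_subgraph)
  qed
  note iso = digraph_iso_iff_induced_copy[OF wf parcs_path_graph_subset]
    digraph_iso_iff_induced_copy[OF wf parcs_two_P3_subset]
    iso_two_P3_with_centres_iff[OF wf Int_lower1]
  have small: "conds ! 4 \<or> conds ! 5 \<or> conds ! 6 \<longleftrightarrow> (\<exists>a b. C.two_stars a b U)"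
    unfolding C.two_stars_iff_induced_copy[OF UV] by (simp add: conds UX UY iso)
  have iii: "conds ! 2 \<longleftrightarrow> (\<exists>y\<in>Yn n. U = Xn n \<union> {y}) \<or> (\<exists>x\<in>Xn n. U = Yn n \<union> {x})"
    by (auto simp: conds Xn_def Yn_def)
  have iv: "conds ! 3 \<longleftrightarrow> (\<exists>x\<in>Xn n. U = Xn n \<union> C.N x) \<or> (\<exists>y\<in>Yn n. U = Yn n \<union> C.N y)"
  proof -
    have "(\<exists>i\<in>Zn n. U = Xn n \<union> {vy i, vy ((i + 1) mod int n)}) \<longleftrightarrow> (\<exists>x\<in>Xn n. U = Xn n \<union> C.N x)"
      using n Zn_shift[of n "\<lambda>i j. U = Xn n \<union> {vy i, vy j}"]
      by (simp add: Xn_def Fn_Image_ux insert_commute)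
    moreover have "(\<exists>i\<in>Zn n. U = Yn n \<union> {ux i, ux ((i + 1) mod int n)}) \<longleftrightarrow> (\<exists>y\<in>Yn n. U = Yn n \<union> C.N y)"
      by (simp add: Yn_def Fn_Image_vy)
    ultimately show ?thesis by (simp add: conds bex_disj_distrib)
  qed
  have ex: "(\<exists>k<7. conds ! k) \<longleftrightarrow> T = {} \<or> C.admissible_remainder U"
  proof -
    have "(\<exists>k<7. conds ! k) \<longleftrightarrow> conds ! 0 \<or> conds ! 1 \<or> conds ! 2 \<or> conds ! 3 \<or>
        (conds ! 4 \<or> conds ! 5 \<or> conds ! 6)"
      by (simp add: Ex_less_Suc numeral_eq_Suc) blast
    also have "\<dots> \<longleftrightarrow> T = {} \<or> C.admissible_remainder U"
      unfolding small iii iv C.admissible_remainder_def by (auto simp: conds)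
    finally show ?thesis .
  qed
  show "T \<in> cut_sets (with_proj (Gn n)) \<longleftrightarrow> (\<exists>k<7. conds ! k)"
  proof (cases "T = {}")
    case True
    then show ?thesis unfolding ex by (simp add: cut_sets_def cut_point_property_def)
  next
    case False
    then have "U \<subset> Xn n \<union> Yn n" using TU UV by blast
    then show ?thesis
      using C.separated_iff_admissible[of U] cut_sets_iff_separates[OF pair_graph_Gn, of T n] T False
      unfolding ex bipartite_complement_Fn[OF n] TU[symmetric] U[symmetric] by simp
  qed
  \<comment> \<open>Each condition determines the unordered pair of sizes, and these differ because \<open>n \<ge> 5\<close>.\<close>
  let ?sizes = "[{(n, n)}, {(n, 0), (0, n)}, {(n, 1), (1, n)}, {(n, 2), (2, n)},
    {(3, 2), (2, 3)}, {(4, 2), (2, 4)}, {(3, 3)}] :: (nat \<times> nat) set list"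
  have disj: "Xn n \<inter> Yn n = {}" "Yn n \<inter> Xn n = {}" by (auto simp: Xn_def Yn_def)
  have "conds ! k \<Longrightarrow> (card UX, card UY) \<in> ?sizes ! k" if "k < 7" for k
  proof -
    assume k: "conds ! k"
    consider "k = 0" | "k = 1" | "k = 2" | "k = 3" | "k = 4" | "k = 5" | "k = 6"
      using \<open>k < 7\<close> by linarith
    then show "(card UX, card UY) \<in> ?sizes ! k"
    proof cases
      case 1
      then have "U = Xn n \<union> Yn n" using k conds U V by simp
      then show ?thesis using 1 disj by (simp add: UX UY Int_Un_distrib2 card_Xn card_Yn)
    next
      case 2
      then have "U = Xn n \<or> U = Yn n" using k conds by simp
      then show ?thesis using 2 disj by (auto simp: UX UY card_Xn card_Yn)
    next
      case 3
      have "(\<exists>y\<in>Yn n. U = Xn n \<union> {y}) \<or> (\<exists>x\<in>Xn n. U = Yn n \<union> {x})" using k 3 iii by simp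
      then have "UX = Xn n \<and> card UY = 1 \<or> UY = Yn n \<and> card UX = 1"
        using disj by (auto simp: UX UY Int_Un_distrib2 Int_insert_left)
      then show ?thesis using 3 by (auto simp: card_Xn card_Yn)
    next
      case 4
      have *: "(\<exists>x\<in>Xn n. U = Xn n \<union> C.N x) \<or> (\<exists>y\<in>Yn n. U = Yn n \<union> C.N y)" using k 4 iv by simp
      have "UX = Xn n \<and> UY = C.N x" if "x \<in> Xn n" "U = Xn n \<union> C.N x" for x
        using that C.N_X[of x] disj unfolding UX UY by blast
      moreover have "UY = Yn n \<and> UX = C.N y" if "y \<in> Yn n" "U = Yn n \<union> C.N y" for y
        using that C.N_Y[of y] disj unfolding UX UY by blast
      ultimately have "UX = Xn n \<and> card UY = 2 \<or> UY = Yn n \<and> card UX = 2"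
        using * C.F_deg by (metis UnCI)
      then show ?thesis using 4 by (auto simp: card_Xn card_Yn)
    qed (use k conds in auto)
  qed
  moreover have "\<forall>j<7. \<forall>k<7. j \<noteq> k \<longrightarrow> ?sizes ! j \<inter> ?sizes ! k = {}"
    using n by (simp add: All_less_Suc numeral_eq_Suc)
  ultimately show "\<forall>j<7. \<forall>k<7. j \<noteq> k \<longrightarrow> \<not> (conds ! j \<and> conds ! k)"
    by (metis disjoint_iff)
qed

end
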